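(* Let $n,p$ be positive integers. Viewed inside $\mathcal{P}_{np}$ through the isometric embedding $\operatorname{bcirc}:(\mathbb{H}^{n\times n\times p}_{++},g)\to(\mathcal{P}_{np},\hat g)$, the Riemannian manifold $(\mathbb{H}^{n\times n\times p}_{++},g)$ is a path-connected and simply connected totally geodesic submanifold of the Riemannian manifold $(\mathcal{P}_{np},\hat g)$.
   Context: A tensor $\mathcal{A}\in\mathbb{C}^{m\times n\times p}$ has frontal slices $A^{(1)},\dots,A^{(p)}\in\mathbb{C}^{m\times n}$. $\operatorname{bcirc}(\mathcal{A})\in\mathbb{C}^{mp\times np}$ is the block circulant matrix whose $(j,l)$ block is $A^{(((j-l)\bmod p)+1)}$ (first block column $A^{(1)},\dots,A^{(p)}$); $\operatorname{unfold}(\mathcal{A})$ is the block column $A^{(1)},\dots,A^{(p)}$, and $\operatorname{fold}$ is its inverse. The T-product is $\mathcal{A}*\mathcal{B}=\operatorname{fold}(\operatorname{bcirc}(\mathcal{A})\cdot\operatorname{unfold}(\mathcal{B}))$; inverses are with respect to $*$ and the identity tensor $\mathcal{I}_{n,p}$ (first frontal slice $I_n$, others zero). The T-conjugate transpose $\mathcal{A}^H$ has frontal slices $(A^{(1)})^H,(A^{(p)})^H,\dots,(A^{(2)})^H$. $\mathbb{H}^{n\times n\times p}$ is the real vector space of T-Hermitian tensors ($\mathcal{A}\in\mathbb{C}^{n\times n\times p}$, $\mathcal{A}^H=\mathcal{A}$). With $\langle\mathcal{A},\mathcal{B}\rangle=\sum_{i,j,k}\overline{a_{ijk}}b_{ijk}$,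 $\mathbb{H}^{n\times n\times p}_{++}$ is the set of T-positive definite tensors, i.e. $\mathcal{A}\in\mathbb{H}^{n\times n\times p}$ with $\langle\mathcal{X},\mathcal{A}*\mathcal{X}\rangle>0$ for all nonzero $\mathcal{X}\in\mathbb{C}^{n\times1\times p}$ (equivalently, $\operatorname{bcirc}(\mathcal{A})$ is Hermitian positive definite). It is an open convex cone in $\mathbb{H}^{n\times n\times p}$ (topology of the Frobenius norm), hence a smooth manifold with $T_{\mathcal{P}}\mathbb{H}^{n\times n\times p}_{++}=\mathbb{H}^{n\times n\times p}$. The trace is $\operatorname{tr}(\mathcal{A})=\operatorname{tr}(\operatorname{bcirc}(\mathcal{A}))$. The Riemannian metric $g$ is $g_{\mathcal{P}}(\mathcal{X},\mathcal{Y})=\operatorname{tr}(\mathcal{P}^{-1}*\mathcal{X}*\mathcal{P}^{-1}*\mathcal{Y})$. $\mathcal{P}_N$ is the manifold of $N\times N$ complex Hermitian positive definite matrices, with tangent space at each point the $N\times N$ Hermitian matrices, and Riemannian metric $\hat g_P(X,Y)=\operatorname{tr}(P^{-1}XP^{-1}Y)$. Totally geodesic means: every geodesic of $(\mathbb{H}^{n\times n\times p}_{++},g)$ is (via $\operatorname{bcirc}$) also a geodesic of the ambient space $(\mathcal{P}_{np},\hat g)$. *)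

theory Defs
  imports "HOL-Analysis.Analysis"
begin

section \<open>Open Riemannian manifolds in linear spaces\<close>

text \<open>
  A Riemannian manifold that is a relatively open subset \<open>points\<close> of a real linear subspace
  \<open>tangent\<close> of a Euclidean space. The subspace is the tangent space at every point and the
  inclusion is a global chart. The metric is only meaningful at \<open>P \<in> points\<close> and on
  \<open>tangent\<close>; its values elsewhere are irrelevant.
\<close>

record 'a open_mfd =
  tangent :: "'a set"
  points :: "'a set"
  rmetric :: "'a \<Rightarrow> 'a \<Rightarrow> 'a \<Rightarrow> real"

definition dirderiv :: "('a::real_normed_vector \<Rightarrow> 'b::real_normed_vector) \<Rightarrow> 'a \<Rightarrow> 'a \<Rightarrow> 'b" where
  "dirderiv f x v = vector_derivative (\<lambda>t. f (x + t *\<^sub>R v)) (at 0)"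

text \<open>
  \<open>f\<close> is \<open>C\<^sup>k\<close> on the relatively open subset \<open>U\<close> of the finite-dimensional subspace \<open>V\<close> iff its
  iterated directional derivatives along \<open>V\<close> up to order \<open>k\<close> exist and are continuous on \<open>U\<close>.
\<close>

primrec Ck_on :: "nat \<Rightarrow> 'a::real_normed_vector set \<Rightarrow> 'a set \<Rightarrow> ('a \<Rightarrow> 'b::real_normed_vector) \<Rightarrow> bool"
where
  "Ck_on 0 V U f = continuous_on U f"
| "Ck_on (Suc k) V U f \<longleftrightarrow> continuous_on U f \<and>
     (\<forall>v\<in>V. (\<forall>x\<in>U. (\<lambda>t::real. f (x + t *\<^sub>R v)) differentiable (at 0)) \<and>
            Ck_on k V U (\<lambda>x. dirderiv f x v))"

definition smooth_on :: "'a::real_normed_vector set \<Rightarrow> 'a set \<Rightarrow> ('a \<Rightarrow> 'b::real_normed_vector) \<Rightarrow> bool" where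
  "smooth_on V U f \<longleftrightarrow> (\<forall>k. Ck_on k V U f)"

definition riemannian_manifold :: "'a::euclidean_space open_mfd \<Rightarrow> bool" where
  "riemannian_manifold M \<longleftrightarrow>
     subspace (tangent M) \<and> openin (top_of_set (tangent M)) (points M) \<and> points M \<noteq> {} \<and>
     (\<forall>P\<in>points M.
        (\<forall>X\<in>tangent M. \<forall>Y\<in>tangent M. rmetric M P X Y = rmetric M P Y X) \<and>
        (\<forall>X\<in>tangent M. \<forall>Y\<in>tangent M. \<forall>Z\<in>tangent M. \<forall>a b.
           rmetric M P (a *\<^sub>R X + b *\<^sub>R Y) Z = a * rmetric M P X Z + b * rmetric M P Y Z) \<and>
        (\<forall>X\<in>tangent M. X \<noteq> 0 \<longrightarrow> rmetric M P X X > 0)) \<and>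
     (\<forall>X\<in>tangent M. \<forall>Y\<in>tangent M. smooth_on (tangent M) (points M) (\<lambda>P. rmetric M P X Y))"

text \<open>
  The Christoffel map of the Levi-Civita connection in the global chart: for constant vector
  fields \<open>X\<close>, \<open>Y\<close> it is the value of \<open>\<nabla>\<^sub>X Y\<close>, determined by the Koszul formula (constant
  fields commute, so the bracket terms vanish).
\<close>

definition christoffel :: "'a::euclidean_space open_mfd \<Rightarrow> 'a \<Rightarrow> 'a \<Rightarrow> 'a \<Rightarrow> 'a" where
  "christoffel M P X Y = (THE W. W \<in> tangent M \<and> (\<forall>Z\<in>tangent M.
     2 * rmetric M P W Z =
       dirderiv (\<lambda>Q. rmetric M Q Y Z) P X + dirderiv (\<lambda>Q. rmetric M Q X Z) P Y
       - dirderiv (\<lambda>Q. rmetric M Q X Y) P Z))"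

definition smooth_curve :: "real set \<Rightarrow> (real \<Rightarrow> 'a::real_normed_vector) \<Rightarrow> bool" where
  "smooth_curve I c \<longleftrightarrow> (\<exists>d. d 0 = c \<and>
     (\<forall>k. \<forall>t\<in>I. (d k has_vector_derivative d (Suc k) t) (at t within I)))"

definition velocity :: "real set \<Rightarrow> (real \<Rightarrow> 'a::real_normed_vector) \<Rightarrow> real \<Rightarrow> 'a" where
  "velocity I c t = vector_derivative c (at t within I)"

text \<open>\<open>\<nabla>\<^bsub>c'\<^esub> c' = c'' + \<Gamma>\<^sub>c(c', c')\<close>\<close>

definition covariant_acceleration ::
  "'a::euclidean_space open_mfd \<Rightarrow> real set \<Rightarrow> (real \<Rightarrow> 'a) \<Rightarrow> real \<Rightarrow> 'a" where
  "covariant_acceleration M I c t =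
     velocity I (velocity I c) t + christoffel M (c t) (velocity I c t) (velocity I c t)"

text \<open>The nondegenerate parameter interval may be open, closed or half-open, bounded or unbounded.\<close>

definition geodesic :: "'a::euclidean_space open_mfd \<Rightarrow> real set \<Rightarrow> (real \<Rightarrow> 'a) \<Rightarrow> bool" where
  "geodesic M I c \<longleftrightarrow>
     is_interval I \<and> (\<exists>s\<in>I. \<exists>t\<in>I. s < t) \<and> c ` I \<subseteq> points M \<and> smooth_curve I c \<and>
     (\<forall>t\<in>I. covariant_acceleration M I c t = 0)"

definition isometric_embedding ::
  "('a::euclidean_space \<Rightarrow> 'b::euclidean_space) \<Rightarrow> 'a open_mfd \<Rightarrow> 'b open_mfd \<Rightarrow> bool" where
  "isometric_embedding f M N \<longleftrightarrow>
     f ` points M \<subseteq> points N \<and>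
     smooth_on (tangent M) (points M) f \<and>
     (\<exists>h. homeomorphism (points M) (f ` points M) f h) \<and>
     (\<forall>P\<in>points M.
        dirderiv f P ` tangent M \<subseteq> tangent N \<and> inj_on (dirderiv f P) (tangent M) \<and>
        (\<forall>X\<in>tangent M. \<forall>Y\<in>tangent M.
           rmetric N (f P) (dirderiv f P X) (dirderiv f P Y) = rmetric M P X Y))"

definition totally_geodesic ::
  "('a::euclidean_space \<Rightarrow> 'b::euclidean_space) \<Rightarrow> 'a open_mfd \<Rightarrow> 'b open_mfd \<Rightarrow> bool" where
  "totally_geodesic f M N \<longleftrightarrow> (\<forall>I c. geodesic M I c \<longrightarrow> geodesic N I (f \<circ> c))"


section \<open>Hermitian positive definite matrices\<close>

definition ctranspose :: "complex^'n^'m \<Rightarrow> complex^'m^'n" where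
  "ctranspose A = (\<chi> i j. cnj (A $ j $ i))"

definition vec_inner :: "complex^'n \<Rightarrow> complex^'n \<Rightarrow> complex" where
  "vec_inner x y = (\<Sum>i\<in>UNIV. cnj (x $ i) * y $ i)"

definition herm_matrices :: "(complex^'n^'n) set" where
  "herm_matrices = {A. ctranspose A = A}"

definition hpd_matrices :: "(complex^'n^'n) set" where
  "hpd_matrices = {A \<in> herm_matrices. \<forall>x. x \<noteq> 0 \<longrightarrow>
     vec_inner x (A *v x) \<in> \<real> \<and> Re (vec_inner x (A *v x)) > 0}"

text \<open>
  The real part only serves the type: the trace is real for \<open>P\<close> in \<open>hpd_matrices\<close> and
  Hermitian \<open>X\<close>, \<open>Y\<close>. The same applies to the tensor metric below.
\<close>

definition hpd_manifold :: "(complex^'n^'n) open_mfd" where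
  "hpd_manifold = \<lparr> tangent = herm_matrices, points = hpd_matrices,
     rmetric = (\<lambda>P X Y. Re (trace (matrix_inv P ** X ** matrix_inv P ** Y))) \<rparr>"


section \<open>Third-order tensors and the T-product\<close>

text \<open>
  A tensor in \<open>\<complex>\<^bsup>m\<times>n\<times>p\<^esup>\<close> has type \<open>complex^'n^'m^'p\<close>, the \<open>'p\<close>-indexed family of its frontal
  slices. The finite linear order on \<open>'p\<close> enumerates the slices: \<open>pos k\<close> is the zero-based
  position of \<open>k\<close>, and \<open>slice A i\<close> is the frontal slice with (one-based) number \<open>(i mod p) + 1\<close>.
\<close>

definition pos :: "'p::{finite,linorder} \<Rightarrow> int" where
  "pos k = int (card {..<k})"

lemma pos_bij: "bij_betw pos (UNIV :: 'p::{finite,linorder} set) {0..<int CARD('p)}"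
proof -
  have less: "pos j < pos k" if "j < k" for j k :: 'p
    unfolding pos_def of_nat_less_iff using that by (intro psubset_card_mono) auto
  have inj: "inj (pos :: 'p \<Rightarrow> int)"
    by (rule injI) (metis less linorder_neqE less_irrefl)
  have "card {..<k} < CARD('p)" for k :: 'p
    by (intro psubset_card_mono) auto
  then have "range (pos :: 'p \<Rightarrow> int) \<subseteq> {0..<int CARD('p)}"
    by (auto simp: pos_def)
  moreover have "card (range (pos :: 'p \<Rightarrow> int)) = card {0..<int CARD('p)}"
    by (simp add: card_image inj)
  ultimately have "range (pos :: 'p \<Rightarrow> int) = {0..<int CARD('p)}"
    by (intro card_subset_eq) auto
  with inj show ?thesis by (simp add: bij_betw_def)
qed

definition slice :: "'a^'p::{finite,linorder} \<Rightarrow> int \<Rightarrow> 'a" where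
  "slice A i = A $ (THE k. pos k = i mod int CARD('p))"

text \<open>Rows and columns of the \<open>mp \<times> np\<close> block matrices are indexed by pairs (block, index in block).\<close>

definition bcirc :: "complex^'n^'m^'p::{finite,linorder} \<Rightarrow> complex^('p \<times> 'n)^('p \<times> 'm)" where
  "bcirc A = (\<chi> r c. slice A (pos (fst r) - pos (fst c)) $ snd r $ snd c)"

definition unfold :: "complex^'n^'m^'p::{finite,linorder} \<Rightarrow> complex^'n^('p \<times> 'm)" where
  "unfold A = (\<chi> r c. A $ fst r $ snd r $ c)"

definition fold :: "complex^'n^('p \<times> 'm) \<Rightarrow> complex^'n^'m^'p::{finite,linorder}" where
  "fold B = (\<chi> k i j. B $ (k, i) $ j)"

lemma fold_unfold: "fold (unfold A) = A" and unfold_fold: "unfold (fold B) = B"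
  by (simp_all add: fold_def unfold_def vec_eq_iff)

definition tprod :: "complex^'n^'m^'p::{finite,linorder} \<Rightarrow> complex^'l^'n^'p::{finite,linorder} \<Rightarrow> complex^'l^'m^'p::{finite,linorder}"
  (infixl \<open>\<star>\<close> 70) where
  "A \<star> B = fold (bcirc A ** unfold B)"

definition tident :: "complex^'n^'n^'p::{finite,linorder}" where
  "tident = (\<chi> k. if pos k = 0 then mat 1 else 0)"

definition tinv :: "complex^'n^'n^'p::{finite,linorder} \<Rightarrow> complex^'n^'n^'p::{finite,linorder}" where
  "tinv A = (SOME B. A \<star> B = tident \<and> B \<star> A = tident)"

text \<open>The slices of \<open>\<A>\<^sup>H\<close> are \<open>(A\<^bsup>(1)\<^esup>)\<^sup>H, (A\<^bsup>(p)\<^esup>)\<^sup>H, \<dots>, (A\<^bsup>(2)\<^esup>)\<^sup>H\<close>.\<close>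

definition tctranspose :: "complex^'n^'m^'p::{finite,linorder} \<Rightarrow> complex^'m^'n^'p::{finite,linorder}" where
  "tctranspose A = (\<chi> k. ctranspose (slice A (- pos k)))"

definition ttrace :: "complex^'n^'n^'p::{finite,linorder} \<Rightarrow> complex" where
  "ttrace A = trace (bcirc A)"

definition tensor_inner :: "complex^'n^'m^'p \<Rightarrow> complex^'n^'m^'p \<Rightarrow> complex" where
  "tensor_inner A B = (\<Sum>i\<in>UNIV. \<Sum>j\<in>UNIV. \<Sum>k\<in>UNIV. cnj (A $ k $ i $ j) * B $ k $ i $ j)"

definition therm_tensors :: "(complex^'n^'n^'p::{finite,linorder}) set" where
  "therm_tensors = {A. tctranspose A = A}"

definition tpd_tensors :: "(complex^'n^'n^'p::{finite,linorder}) set" where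
  "tpd_tensors = {A \<in> therm_tensors. \<forall>X :: complex^1^'n^'p::{finite,linorder}. X \<noteq> 0 \<longrightarrow>
     tensor_inner X (A \<star> X) \<in> \<real> \<and> Re (tensor_inner X (A \<star> X)) > 0}"

definition tpd_manifold :: "(complex^'n^'n^'p::{finite,linorder}) open_mfd" where
  "tpd_manifold = \<lparr> tangent = therm_tensors, points = tpd_tensors,
     rmetric = (\<lambda>P X Y. Re (ttrace (tinv P \<star> X \<star> tinv P \<star> Y))) \<rparr>"

end

theory Submission
  imports Defs
begin

text \<open>
  The Levi-Civita connection of the trace metric on positive definite matrices is algebraic. In the
  global chart its Christoffel map is \<open>\<Gamma>\<^sub>P(X, Y) = - 1/2 (X P\<^sup>-\<^sup>1 Y + Y P\<^sup>-\<^sup>1 X)\<close>, which follows from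
  \<open>(P\<^sup>-\<^sup>1)' = - P\<^sup>-\<^sup>1 P' P\<^sup>-\<^sup>1\<close> and the cyclicity of the trace (\<open>koszul_hpd\<close>). The map \<open>bcirc\<close> is linear,
  injective and multiplicative (\<open>bcirc_tprod\<close>), it respects the identity and the conjugate transpose,
  and hence also inverses (\<open>bcirc_tinv\<close>). So the block circulant matrices form a linear space that is
  closed under \<open>\<Gamma>\<close>: if \<open>P\<close>, \<open>X\<close>, \<open>Y\<close> lie in it, so does \<open>\<Gamma>\<^sub>P(X, Y)\<close> (\<open>koszul_bcirc_range\<close>).

  T-Hermitian and T-positive definite tensors are exactly the tensors whose image under \<open>bcirc\<close> is
  Hermitian, respectively positive definite (\<open>therm_iff\<close>, \<open>tpd_iff\<close>), and the tensor metric is the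
  matrix metric pulled back along \<open>bcirc\<close>. The locale \<open>linear_pullback\<close> treats this situation for an
  arbitrary injective linear map \<open>L\<close>: the pulled-back manifold is Riemannian, \<open>L\<close> is an isometric
  embedding, and if the Koszul solutions of the ambient space for vectors in the range of \<open>L\<close> stay in
  that range, then \<open>L\<close> intertwines the two Christoffel maps, so that \<open>c'' + \<Gamma>\<^sub>c(c', c') = 0\<close> is carried
  to the same equation for \<open>L \<circ> c\<close>.

  What remains about matrices is that the trace metric is smooth and positive definite. Smoothness is
  an induction on the order, because the derivative of the inversion is a polynomial in the inversion.
  Positivity rests on a factorisation \<open>P\<^sup>-\<^sup>1 = R R\<^sup>H\<close> (\<open>psd_gram\<close>), by which
  \<open>tr (P\<^sup>-\<^sup>1 X P\<^sup>-\<^sup>1 X)\<close> is the squared Frobenius norm of \<open>R\<^sup>H X R\<close>. Finally, the positive definite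
  tensors form a convex set, which makes them path-connected and simply connected.
\<close>

section \<open>Iterated directional derivatives\<close>

text \<open>
  A directional derivative at a point of a relatively open set only sees the values on that set. This
  is what allows functions to be replaced by others that agree with them on the manifold alone, such as
  inverses, which have no meaning at singular matrices.
\<close>

lemma eventually_line_in_openin:
  fixes V U :: "'a::real_normed_vector set"
  assumes "subspace V" "openin (top_of_set V) U" "x \<in> U" "v \<in> V"
  shows "\<forall>\<^sub>F t in nhds (0::real). x + t *\<^sub>R v \<in> U"
proof -
  obtain T where T: "open T" "U = V \<inter> T"
    using assms(2) by (auto simp: openin_open)
  have inV: "x + t *\<^sub>R v \<in> V" for t
    using assms T by (intro subspace_add subspace_scale) auto
  have "((\<lambda>t. x + t *\<^sub>R v) \<longlongrightarrow> x + 0 *\<^sub>R v) (nhds 0)"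
    by (intro tendsto_intros) (auto simp: filterlim_ident)
  then have "\<forall>\<^sub>F t in nhds (0::real). x + t *\<^sub>R v \<in> T"
    using T assms(3) by (auto simp: tendsto_def)
  then show ?thesis by eventually_elim (use inV T in auto)
qed

lemma dirderivI:
  assumes "((\<lambda>t. f (x + t *\<^sub>R v)) has_vector_derivative D) (at 0)"
  shows "dirderiv f x v = D"
  using assms unfolding dirderiv_def by (rule vector_derivative_at)

lemma dirderiv_cong:
  fixes V U :: "'a::real_normed_vector set"
  assumes "subspace V" "openin (top_of_set V) U" "\<And>y. y \<in> U \<Longrightarrow> f y = g y" "x \<in> U" "v \<in> V"
  shows "dirderiv f x v = dirderiv g x v"
  unfolding dirderiv_def
  using eventually_line_in_openin[OF assms(1,2,4,5)] assms(3)
  by (intro vector_derivative_cong_eq) (auto elim: eventually_mono)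

lemma Ck_on_SucI:
  fixes V U :: "'a::real_normed_vector set"
  assumes "continuous_on U f"
    and "\<And>v x. v \<in> V \<Longrightarrow> x \<in> U \<Longrightarrow>
           ((\<lambda>t::real. f (x + t *\<^sub>R v)) has_vector_derivative D v x) (at 0)"
    and "\<And>v. v \<in> V \<Longrightarrow> Ck_on k V U (\<lambda>x. dirderiv f x v)"
  shows "Ck_on (Suc k) V U f"
  using assms by (auto intro: differentiableI_vector)

lemma Ck_on_SucD:
  assumes "Ck_on (Suc k) V U f"
  shows "continuous_on U f"
    and "v \<in> V \<Longrightarrow> x \<in> U \<Longrightarrow>
           ((\<lambda>t::real. f (x + t *\<^sub>R v)) has_vector_derivative dirderiv f x v) (at 0)"
    and "v \<in> V \<Longrightarrow> Ck_on k V U (\<lambda>x. dirderiv f x v)"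
  using assms by (auto simp: dirderiv_def vector_derivative_works)

lemma Ck_on_Suc_imp: "Ck_on (Suc k) V U f \<Longrightarrow> Ck_on k V U f"
  by (induction k arbitrary: f) auto

lemma Ck_on_cong:
  fixes V U :: "'a::real_normed_vector set"
  assumes "subspace V" "openin (top_of_set V) U"
    and "\<And>y. y \<in> U \<Longrightarrow> f y = g y" "Ck_on k V U f"
  shows "Ck_on k V U g"
  using assms(3,4)
proof (induction k arbitrary: f g)
  case 0
  then show ?case by (auto cong: continuous_on_cong)
next
  case (Suc k)
  show ?case
  proof (rule Ck_on_SucI)
    show "continuous_on U g"
      using Ck_on_SucD(1)[OF Suc.prems(2)] Suc.prems(1) by (auto cong: continuous_on_cong)
  next
    fix v x assume vx: "v \<in> V" "x \<in> U"
    have "((\<lambda>t. g (x + t *\<^sub>R v)) has_vector_derivative dirderiv f x v) (at 0) \<longleftrightarrow>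
          ((\<lambda>t. f (x + t *\<^sub>R v)) has_vector_derivative dirderiv f x v) (at 0)"
      using eventually_line_in_openin[OF assms(1,2) vx(2,1)] Suc.prems(1) vx
      by (intro has_vector_derivative_cong_ev) (auto elim: eventually_mono)
    then show "((\<lambda>t. g (x + t *\<^sub>R v)) has_vector_derivative dirderiv f x v) (at 0)"
      using Ck_on_SucD(2)[OF Suc.prems(2) vx] by blast
  next
    fix v assume v: "v \<in> V"
    show "Ck_on k V U (\<lambda>x. dirderiv g x v)"
      using Ck_on_SucD(3)[OF Suc.prems(2) v]
      by (rule Suc.IH[rotated]) (use Suc.prems(1) v in \<open>auto intro: dirderiv_cong[OF assms(1,2)]\<close>)
  qed
qed

lemma Ck_on_const: "Ck_on k V U (\<lambda>x. c)"
proof (induction k arbitrary: c)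
  case (Suc k)
  have "dirderiv (\<lambda>x. c) x v = 0" for x v :: 'a
    by (rule dirderivI) simp
  with Suc show ?case by simp
qed simp

lemma Ck_on_bounded_linear:
  assumes "bounded_linear h" "Ck_on k V U f" "subspace V" "openin (top_of_set V) U"
  shows "Ck_on k V U (\<lambda>x. h (f x))"
  using assms(2)
proof (induction k arbitrary: f)
  case 0
  then show ?case by (auto intro: bounded_linear.continuous_on[OF assms(1)])
next
  case (Suc k)
  note f = Ck_on_SucD[OF Suc.prems]
  have der: "((\<lambda>t. h (f (x + t *\<^sub>R v))) has_vector_derivative h (dirderiv f x v)) (at 0)"
    if "v \<in> V" "x \<in> U" for v x
    using bounded_linear.has_vector_derivative[OF assms(1) f(2)[OF that]] .
  show ?case
  proof (rule Ck_on_SucI)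
    show "continuous_on U (\<lambda>x. h (f x))"
      by (intro bounded_linear.continuous_on[OF assms(1)] f)
    show "Ck_on k V U (\<lambda>x. dirderiv (\<lambda>x. h (f x)) x v)" if "v \<in> V" for v
      using Suc.IH[OF f(3)[OF that]]
      by (rule Ck_on_cong[OF assms(3,4), rotated]) (rule sym, rule dirderivI, rule der[OF that])
  qed (use der in blast)
qed

lemma Ck_on_add:
  assumes "Ck_on k V U f" "Ck_on k V U g" "subspace V" "openin (top_of_set V) U"
  shows "Ck_on k V U (\<lambda>x. f x + g x)"
  using assms(1,2)
proof (induction k arbitrary: f g)
  case 0
  then show ?case by (auto intro: continuous_intros)
next
  case (Suc k)
  note f = Ck_on_SucD[OF Suc.prems(1)] and g = Ck_on_SucD[OF Suc.prems(2)]
  have der: "((\<lambda>t. f (x + t *\<^sub>R v) + g (x + t *\<^sub>R v)) has_vector_derivative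
      dirderiv f x v + dirderiv g x v) (at 0)" if "v \<in> V" "x \<in> U" for v x
    using f(2)[OF that] g(2)[OF that] by (rule has_vector_derivative_add)
  show ?case
  proof (rule Ck_on_SucI)
    show "continuous_on U (\<lambda>x. f x + g x)"
      by (intro continuous_intros f g)
    show "Ck_on k V U (\<lambda>x. dirderiv (\<lambda>x. f x + g x) x v)" if "v \<in> V" for v
      using Suc.IH[OF f(3)[OF that] g(3)[OF that]]
      by (rule Ck_on_cong[OF assms(3,4), rotated]) (rule sym, rule dirderivI, rule der[OF that])
  qed (use der in blast)
qed

text \<open>
  By the product rule the derivative of \<open>h (f x) (g x)\<close> is again a sum of such products, with one
  factor differentiated; the induction hypothesis applies to both of them since the other factor is
  also of the lower order.
\<close>

lemma Ck_on_bounded_bilinear: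
  assumes h: "bounded_bilinear h"
    and "Ck_on k V U f" "Ck_on k V U g" "subspace V" "openin (top_of_set V) U"
  shows "Ck_on k V U (\<lambda>x. h (f x) (g x))"
  using assms(2,3)
proof (induction k arbitrary: f g)
  case 0
  then show ?case by (auto intro: bounded_bilinear.continuous_on[OF h])
next
  case (Suc k)
  note f = Ck_on_SucD[OF Suc.prems(1)] and g = Ck_on_SucD[OF Suc.prems(2)]
  note low = Suc.prems[THEN Ck_on_Suc_imp]
  have der: "((\<lambda>t. h (f (x + t *\<^sub>R v)) (g (x + t *\<^sub>R v))) has_vector_derivative
      h (f x) (dirderiv g x v) + h (dirderiv f x v) (g x)) (at 0)" if "v \<in> V" "x \<in> U" for v x
    using bounded_bilinear.has_vector_derivative[OF h f(2)[OF that] g(2)[OF that]] by simp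
  show ?case
  proof (rule Ck_on_SucI)
    show "continuous_on U (\<lambda>x. h (f x) (g x))"
      by (intro bounded_bilinear.continuous_on[OF h] f g)
    show "Ck_on k V U (\<lambda>x. dirderiv (\<lambda>x. h (f x) (g x)) x v)" if "v \<in> V" for v
      using Ck_on_add[OF Suc.IH[OF low(1) g(3)[OF that]] Suc.IH[OF f(3)[OF that] low(2)] assms(4,5)]
      by (rule Ck_on_cong[OF assms(4,5), rotated]) (rule sym, rule dirderivI, rule der[OF that])
  qed (use der in blast)
qed

lemma dirderiv_compose_linear:
  assumes "linear L"
  shows "dirderiv (\<lambda>x. f (L x)) x v = dirderiv f (L x) (L v)"
  unfolding dirderiv_def by (simp add: linear_add[OF assms] linear_scale[OF assms])

lemma Ck_on_compose_linear:
  assumes L: "bounded_linear L" and "L ` V \<subseteq> W" "L ` U \<subseteq> T" "Ck_on k W T f"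
  shows "Ck_on k V U (\<lambda>x. f (L x))"
  using assms(4)
proof (induction k arbitrary: f)
  case 0
  then show ?case
    using assms(3) continuous_on_compose2[OF _ linear_continuous_on[OF L]] by fastforce
next
  case (Suc k)
  note f = Ck_on_SucD[OF Suc.prems] and lin = bounded_linear.linear[OF L]
  show ?case
  proof (rule Ck_on_SucI)
    show "continuous_on U (\<lambda>x. f (L x))"
      using assms(3) continuous_on_compose2[OF f(1) linear_continuous_on[OF L]] by blast
    show "((\<lambda>t. f (L (x + t *\<^sub>R v))) has_vector_derivative dirderiv f (L x) (L v)) (at 0)"
      if "v \<in> V" "x \<in> U" for v x
      using f(2)[of "L v" "L x"] that assms(2,3)
      by (auto simp: linear_add[OF lin] linear_scale[OF lin])
    show "Ck_on k V U (\<lambda>x. dirderiv (\<lambda>x. f (L x)) x v)" if "v \<in> V" for v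
      unfolding dirderiv_compose_linear[OF lin] using f(3)[of "L v"] that assms(2)
      by (intro Suc.IH) auto
  qed
qed

lemma has_vector_derivative_bounded_linear_along:
  assumes "bounded_linear L"
  shows "((\<lambda>t. L (x + t *\<^sub>R v)) has_vector_derivative L v) (at 0)"
proof -
  have "((\<lambda>t. x + t *\<^sub>R v) has_vector_derivative v) (at 0)"
    by (auto intro!: derivative_eq_intros)
  then show ?thesis by (rule bounded_linear.has_vector_derivative[OF assms])
qed

lemma dirderiv_bounded_linear: "bounded_linear L \<Longrightarrow> dirderiv L x v = L v"
  by (rule dirderivI) (rule has_vector_derivative_bounded_linear_along)

lemma Ck_on_bounded_linear_self:
  assumes "bounded_linear L"
  shows "Ck_on k V U L"
proof (cases k)
  case 0
  then show ?thesis by (simp add: linear_continuous_on[OF assms])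
next
  case (Suc m)
  show ?thesis unfolding Suc
    by (intro Ck_on_SucI)
       (auto simp: linear_continuous_on[OF assms] dirderiv_bounded_linear[OF assms] Ck_on_const
         intro: has_vector_derivative_bounded_linear_along[OF assms])
qed

section \<open>Christoffel maps and pullbacks under injective linear maps\<close>

text \<open>
  The property that \<open>christoffel\<close> selects by a definite description. It is kept separate so that an
  explicit solution can be exhibited and transported before uniqueness is invoked.
\<close>

definition koszul :: "'a::euclidean_space open_mfd \<Rightarrow> 'a \<Rightarrow> 'a \<Rightarrow> 'a \<Rightarrow> 'a \<Rightarrow> bool" where
  "koszul M P X Y W \<longleftrightarrow> W \<in> tangent M \<and> (\<forall>Z\<in>tangent M.
     2 * rmetric M P W Z =
       dirderiv (\<lambda>Q. rmetric M Q Y Z) P X + dirderiv (\<lambda>Q. rmetric M Q X Z) P Y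
       - dirderiv (\<lambda>Q. rmetric M Q X Y) P Z)"

text \<open>
  Two solutions have the same inner product with every tangent vector, in particular with their own
  difference, which therefore vanishes by positive definiteness.
\<close>

lemma christoffel_eqI:
  assumes M: "riemannian_manifold M" and P: "P \<in> points M" and W: "koszul M P X Y W"
  shows "christoffel M P X Y = W"
  unfolding christoffel_def koszul_def[symmetric]
proof (rule the_equality)
  show "koszul M P X Y W" by (rule W)
next
  fix W' assume W': "koszul M P X Y W'"
  have sub: "subspace (tangent M)" using M by (simp add: riemannian_manifold_def)
  have tan: "W \<in> tangent M" "W' \<in> tangent M" using W W' by (auto simp: koszul_def)
  define D where "D = W' - W"
  have D: "D \<in> tangent M" unfolding D_def using tan sub by (simp add: subspace_diff)
  have lin: "rmetric M P (a *\<^sub>R X + b *\<^sub>R Y) Z = a * rmetric M P X Z + b * rmetric M P Y Z"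
    if "X \<in> tangent M" "Y \<in> tangent M" "Z \<in> tangent M" for X Y Z a b
    using M P that unfolding riemannian_manifold_def by blast
  have "rmetric M P D D = rmetric M P (1 *\<^sub>R W' + (-1) *\<^sub>R W) D"
    by (simp add: D_def)
  also have "\<dots> = rmetric M P W' D - rmetric M P W D"
    by (subst lin) (use tan D in auto)
  also have "\<dots> = 0"
  proof -
    have "2 * rmetric M P W' D = 2 * rmetric M P W D"
      using W W' D unfolding koszul_def by metis
    then show ?thesis by simp
  qed
  finally have "\<not> rmetric M P D D > 0" by simp
  then have "D = 0" using M P D unfolding riemannian_manifold_def by blast
  then show "W' = W" by (simp add: D_def)
qed

text \<open>
  A manifold \<open>M\<close> that is cut out of \<open>N\<close> by an injective linear map of the ambient spaces and carries the
  induced metric. The metrics are compared at points and on tangent vectors of \<open>M\<close> only, because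
  elsewhere their values are arbitrary.
\<close>

locale linear_pullback =
  fixes L :: "'a::euclidean_space \<Rightarrow> 'b::euclidean_space"
    and M :: "'a open_mfd" and N :: "'b open_mfd"
  assumes linear: "linear L" and inj: "inj L"
    and tangent_iff: "X \<in> tangent M \<longleftrightarrow> L X \<in> tangent N"
    and points_iff: "P \<in> points M \<longleftrightarrow> L P \<in> points N"
    and rmetric_eq: "P \<in> points M \<Longrightarrow> X \<in> tangent M \<Longrightarrow> Y \<in> tangent M \<Longrightarrow>
          rmetric M P X Y = rmetric N (L P) (L X) (L Y)"
    and ambient: "riemannian_manifold N"
    and nonempty: "points M \<noteq> {}"
begin

lemma bounded: "bounded_linear L"
  using linear by (simp add: linear_conv_bounded_linear)

lemma subspace_tangent: "subspace (tangent M)"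
proof -
  have "tangent M = L -` tangent N" using tangent_iff by auto
  moreover have "subspace (tangent N)" using ambient by (simp add: riemannian_manifold_def)
  ultimately show ?thesis
    using linear_subspace_vimage[OF linear] by simp
qed

lemma openin_points: "openin (top_of_set (tangent M)) (points M)"
proof -
  have *: "openin (top_of_set (tangent N)) (points N)"
    using ambient by (simp add: riemannian_manifold_def)
  have "openin (top_of_set (tangent M)) (tangent M \<inter> L -` points N)"
    by (rule continuous_openin_preimage[OF linear_continuous_on[OF bounded] _ *])
       (use tangent_iff in auto)
  moreover have "tangent M \<inter> L -` points N = points M"
    using points_iff tangent_iff openin_imp_subset[OF *] by auto
  ultimately show ?thesis by simp
qed

lemma points_subset: "points M \<subseteq> tangent M"
  using openin_imp_subset[OF openin_points] .

lemma dirderiv_rmetric: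
  assumes "P \<in> points M" "V \<in> tangent M" "X \<in> tangent M" "Y \<in> tangent M"
  shows "dirderiv (\<lambda>Q. rmetric M Q X Y) P V = dirderiv (\<lambda>Q. rmetric N Q (L X) (L Y)) (L P) (L V)"
proof -
  have "dirderiv (\<lambda>Q. rmetric M Q X Y) P V = dirderiv (\<lambda>Q. rmetric N (L Q) (L X) (L Y)) P V"
    by (rule dirderiv_cong[OF subspace_tangent openin_points]) (use assms rmetric_eq in auto)
  also have "\<dots> = dirderiv (\<lambda>Q. rmetric N Q (L X) (L Y)) (L P) (L V)"
    by (rule dirderiv_compose_linear[OF linear])
  finally show ?thesis .
qed

lemma riemannian: "riemannian_manifold M"
  unfolding riemannian_manifold_def
proof (intro conjI ballI allI impI)
  show "subspace (tangent M)" by (rule subspace_tangent)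
  show "openin (top_of_set (tangent M)) (points M)" by (rule openin_points)
  show "points M \<noteq> {}" by (rule nonempty)
next
  fix P X Y assume *: "P \<in> points M" "X \<in> tangent M" "Y \<in> tangent M"
  then show "rmetric M P X Y = rmetric M P Y X"
    using ambient unfolding riemannian_manifold_def
    by (simp add: rmetric_eq) (use tangent_iff points_iff in auto)
next
  fix P X Y Z and a b :: real
  assume *: "P \<in> points M" "X \<in> tangent M" "Y \<in> tangent M" "Z \<in> tangent M"
  then have "a *\<^sub>R X + b *\<^sub>R Y \<in> tangent M"
    using subspace_tangent by (simp add: subspace_add subspace_scale)
  moreover have "rmetric N (L P) (a *\<^sub>R L X + b *\<^sub>R L Y) (L Z) =
      a * rmetric N (L P) (L X) (L Z) + b * rmetric N (L P) (L Y) (L Z)"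
    using ambient * tangent_iff points_iff unfolding riemannian_manifold_def by blast
  ultimately show "rmetric M P (a *\<^sub>R X + b *\<^sub>R Y) Z = a * rmetric M P X Z + b * rmetric M P Y Z"
    using * by (simp add: rmetric_eq linear_add[OF linear] linear_scale[OF linear])
next
  fix P X assume *: "P \<in> points M" "X \<in> tangent M" "X \<noteq> 0"
  then have "L X \<noteq> 0" using inj linear by (metis injD linear_0)
  then show "0 < rmetric M P X X"
    using * ambient tangent_iff points_iff unfolding riemannian_manifold_def
    by (simp add: rmetric_eq)
next
  fix X Y assume *: "X \<in> tangent M" "Y \<in> tangent M"
  show "smooth_on (tangent M) (points M) (\<lambda>P. rmetric M P X Y)"
    unfolding smooth_on_def
  proof
    fix k
    have "Ck_on k (tangent N) (points N) (\<lambda>P. rmetric N P (L X) (L Y))"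
      using ambient * tangent_iff by (auto simp: riemannian_manifold_def smooth_on_def)
    then have "Ck_on k (tangent M) (points M) (\<lambda>P. rmetric N (L P) (L X) (L Y))"
      by (rule Ck_on_compose_linear[OF bounded, rotated 2]) (use tangent_iff points_iff in auto)
    then show "Ck_on k (tangent M) (points M) (\<lambda>P. rmetric M P X Y)"
      by (rule Ck_on_cong[OF subspace_tangent openin_points, rotated]) (use * rmetric_eq in auto)
  qed
qed

lemma isometric: "isometric_embedding L M N"
  unfolding isometric_embedding_def
proof (intro conjI ballI)
  show "L ` points M \<subseteq> points N" using points_iff by auto
  show "smooth_on (tangent M) (points M) L"
    by (simp add: smooth_on_def Ck_on_bounded_linear_self[OF bounded])
  obtain h where h: "linear h" "h \<circ> L = id"
    using linear_injective_left_inverse[OF linear inj] by blast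
  have "homeomorphism (points M) (L ` points M) L h"
    using h linear_continuous_on[OF bounded] linear_continuous_on[of h]
    by (intro homeomorphismI) (auto simp: linear_conv_bounded_linear fun_eq_iff)
  then show "\<exists>h. homeomorphism (points M) (L ` points M) L h" by blast
next
  fix P
  have eq: "dirderiv L P = L" by (rule ext) (rule dirderiv_bounded_linear[OF bounded])
  show "dirderiv L P ` tangent M \<subseteq> tangent N" using tangent_iff by (auto simp: eq)
  show "inj_on (dirderiv L P) (tangent M)" using inj by (auto simp: eq inj_on_def)
next
  fix P X Y assume "P \<in> points M" "X \<in> tangent M" "Y \<in> tangent M"
  then show "rmetric N (L P) (dirderiv L P X) (dirderiv L P Y) = rmetric M P X Y"
    by (simp add: dirderiv_bounded_linear[OF bounded] rmetric_eq)
qed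

text \<open>
  The metric on \<open>M\<close> and its derivatives are those of \<open>N\<close> on the range of \<open>L\<close>. A Koszul solution of \<open>N\<close>
  that happens to be of the form \<open>L W\<close> therefore yields the solution \<open>W\<close> in \<open>M\<close>, without any orthogonal
  projection; this is the vanishing of the second fundamental form.
\<close>

lemma christoffel_eq:
  assumes "P \<in> points M" "X \<in> tangent M" "Y \<in> tangent M" and W: "koszul N (L P) (L X) (L Y) (L W)"
  shows "L (christoffel M P X Y) = christoffel N (L P) (L X) (L Y)"
proof -
  have "W \<in> tangent M" using W tangent_iff by (simp add: koszul_def)
  then have "koszul M P X Y W"
    using W assms tangent_iff by (simp add: koszul_def rmetric_eq dirderiv_rmetric)
  then have "christoffel M P X Y = W"
    using christoffel_eqI[OF riemannian] assms by blast
  moreover have "christoffel N (L P) (L X) (L Y) = L W"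
    using christoffel_eqI[OF ambient _ W] assms points_iff by blast
  ultimately show ?thesis by simp
qed

end

text \<open>
  One-sided derivatives at the end points of the parameter interval are unique because no point of a
  nondegenerate interval is isolated.
\<close>

lemma at_within_interval_nontrivial:
  fixes I :: "real set"
  assumes "is_interval I" "s \<in> I" "t \<in> I" "s < t" "x \<in> I"
  shows "at x within I \<noteq> bot"
proof -
  have "connected I" using assms by (simp add: is_interval_connected_1)
  moreover have "\<not> is_singleton I" "I \<noteq> {x}" using assms by (auto simp: is_singleton_def)
  ultimately have "x islimpt I" by (intro connected_imp_perfect) (use assms in auto)
  then show ?thesis by (simp add: trivial_limit_within)
qed

lemma has_vector_derivative_iff_quotient:
  "(c has_vector_derivative D) (at t within I) \<longleftrightarrow>
   ((\<lambda>x. (c x - c t) /\<^sub>R (x - t)) \<longlongrightarrow> D) (at t within I)"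
proof -
  have "(c has_vector_derivative D) (at t within I) \<longleftrightarrow>
      ((\<lambda>x. norm ((c x - c t) - (x - t) *\<^sub>R D) / norm (x - t)) \<longlongrightarrow> 0) (at t within I)"
    by (simp add: has_vector_derivative_def has_derivative_iff_norm bounded_linear_scaleR_left)
  also have "\<dots> \<longleftrightarrow> ((\<lambda>x. norm ((c x - c t) /\<^sub>R (x - t) - D)) \<longlongrightarrow> 0) (at t within I)"
  proof (rule filterlim_cong[OF refl refl])
    show "\<forall>\<^sub>F x in at t within I. norm ((c x - c t) - (x - t) *\<^sub>R D) / norm (x - t) =
        norm ((c x - c t) /\<^sub>R (x - t) - D)"
      unfolding eventually_at_filter
    proof (intro always_eventually allI impI)
      fix x assume "x \<noteq> t"
      then have "(c x - c t) /\<^sub>R (x - t) - D = ((c x - c t) - (x - t) *\<^sub>R D) /\<^sub>R (x - t)"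
        by (simp add: scaleR_diff_right)
      then show "norm ((c x - c t) - (x - t) *\<^sub>R D) / norm (x - t) =
          norm ((c x - c t) /\<^sub>R (x - t) - D)"
        by (simp add: divide_inverse_commute)
    qed
  qed
  also have "\<dots> \<longleftrightarrow> ((\<lambda>x. (c x - c t) /\<^sub>R (x - t)) \<longlongrightarrow> D) (at t within I)"
    by (simp add: tendsto_norm_zero_iff flip: Lim_null)
  finally show ?thesis .
qed

lemma has_vector_derivative_in_subspace:
  fixes c :: "real \<Rightarrow> 'a::euclidean_space"
  assumes "(c has_vector_derivative D) (at t within I)" "at t within I \<noteq> bot"
    and "subspace V" "c ` I \<subseteq> V" "t \<in> I"
  shows "D \<in> V"
proof -
  have "((\<lambda>x. (c x - c t) /\<^sub>R (x - t)) \<longlongrightarrow> D) (at t within I)"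
    using assms(1) by (simp add: has_vector_derivative_iff_quotient)
  moreover have "\<forall>\<^sub>F x in at t within I. (c x - c t) /\<^sub>R (x - t) \<in> V"
    using assms(3-5) by (auto simp: eventually_at_filter subspace_diff subspace_scale image_subset_iff)
  ultimately show ?thesis
    by - (rule Lim_in_closed_set[OF closed_subspace[OF assms(3)] _ assms(2)])
qed

text \<open>
  Replaces the nested \<open>velocity\<close> terms by given first and second derivatives. The function \<open>velocity I c\<close>
  agrees with the first derivative on \<open>I\<close> only, which suffices for a derivative within \<open>I\<close>.
\<close>

lemma covariant_acceleration_eq:
  assumes nt: "\<And>t. t \<in> I \<Longrightarrow> at t within I \<noteq> bot"
    and d: "\<And>t. t \<in> I \<Longrightarrow> (c has_vector_derivative d t) (at t within I)"
      "\<And>t. t \<in> I \<Longrightarrow> (d has_vector_derivative e t) (at t within I)"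
    and t: "t \<in> I"
  shows "covariant_acceleration M I c t = e t + christoffel M (c t) (d t) (d t)"
proof -
  have vel: "velocity I c s = d s" if "s \<in> I" for s
    unfolding velocity_def using vector_derivative_within[OF nt d(1)] that by blast
  have "(velocity I c has_vector_derivative e t) (at t within I)"
    by (rule has_vector_derivative_transform[OF t _ d(2)[OF t]]) (simp add: vel)
  then have "velocity I (velocity I c) t = e t"
    unfolding velocity_def[of _ "velocity I c"] using vector_derivative_within[OF nt[OF t]] by blast
  then show ?thesis by (simp add: covariant_acceleration_def vel t)
qed

context linear_pullback
begin

text \<open>
  Only the quadratic part of the Christoffel map enters the geodesic equation, so the hypothesis is
  needed with both vectors equal to the velocity, which is tangent because \<open>tangent M\<close> is closed.
\<close>

lemma totally_geodesicI:
  assumes koszul: "\<And>P X. P \<in> points M \<Longrightarrow> X \<in> tangent M \<Longrightarrow>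
      \<exists>W. koszul N (L P) (L X) (L X) (L W)"
  shows "totally_geodesic L M N"
  unfolding totally_geodesic_def
proof (intro allI impI)
  fix I c assume geo: "geodesic M I c"
  then obtain s r where I: "is_interval I" "s \<in> I" "r \<in> I" "s < r"
    by (auto simp: geodesic_def)
  note nt = at_within_interval_nontrivial[OF I]
  obtain d where d: "d 0 = c"
    "\<And>k t. t \<in> I \<Longrightarrow> (d k has_vector_derivative d (Suc k) t) (at t within I)"
    using geo by (auto simp: geodesic_def smooth_curve_def)
  have c: "c ` I \<subseteq> points M" using geo by (simp add: geodesic_def)
  have Ld: "((L \<circ> d k) has_vector_derivative (L \<circ> d (Suc k)) t) (at t within I)" if "t \<in> I" for k t
    using bounded_linear.has_vector_derivative[OF bounded d(2)[OF that]] by (simp add: o_def)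
  note d01 = d(2)[of _ 0, unfolded d(1)] and Ld01 = Ld[of _ 0, unfolded d(1)]
  show "geodesic N I (L \<circ> c)"
    unfolding geodesic_def
  proof (intro conjI ballI)
    show "is_interval I" by (rule I)
    show "\<exists>s\<in>I. \<exists>t\<in>I. s < t" using I by blast
    show "(L \<circ> c) ` I \<subseteq> points N" using c points_iff by auto
    show "smooth_curve I (L \<circ> c)"
      unfolding smooth_curve_def using d(1) Ld by (intro exI[of _ "\<lambda>k. L \<circ> d k"]) auto
  next
    fix t assume t: "t \<in> I"
    have P: "c t \<in> points M" using c t by blast
    have X: "d 1 t \<in> tangent M"
      using has_vector_derivative_in_subspace[OF d01[OF t] nt[OF t] subspace_tangent] c points_subset t
      by (auto simp: image_subset_iff)
    have "0 = covariant_acceleration M I c t" using geo t by (simp add: geodesic_def)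
    also have "\<dots> = d 2 t + christoffel M (c t) (d 1 t) (d 1 t)"
      by (rule covariant_acceleration_eq[OF nt _ _ t])
         (use d01 d(2)[of _ 1] in \<open>simp_all add: numeral_2_eq_2\<close>)
    finally have "0 = L (d 2 t + christoffel M (c t) (d 1 t) (d 1 t))"
      using linear_0[OF linear] by simp
    also have "\<dots> = L (d 2 t) + christoffel N (L (c t)) (L (d 1 t)) (L (d 1 t))"
      using koszul[OF P X] christoffel_eq[OF P X X] by (auto simp: linear_add[OF linear])
    also have "\<dots> = covariant_acceleration N I (L \<circ> c) t"
      by (subst covariant_acceleration_eq[OF nt Ld01 _ t, of "\<lambda>t. L (d 2 t)"])
         (use Ld[of _ 1] in \<open>simp_all add: numeral_2_eq_2 o_def\<close>)
    finally show "covariant_acceleration N I (L \<circ> c) t = 0" ..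
  qed
qed

end

section \<open>Matrix algebra\<close>

interpretation matmul: bounded_bilinear
  "(**) :: complex^'n^'m \<Rightarrow> complex^'k^'n \<Rightarrow> complex^'k^'m"
proof -
  have "bilinear ((**) :: complex^'n^'m \<Rightarrow> complex^'k^'n \<Rightarrow> complex^'k^'m)"
    by (auto simp: bilinear_def linear_iff matrix_matrix_mult_def vec_eq_iff algebra_simps
          sum.distrib scaleR_sum_right)
  then show "bounded_bilinear ((**) :: complex^'n^'m \<Rightarrow> complex^'k^'n \<Rightarrow> complex^'k^'m)"
    by (simp add: bilinear_conv_bounded_bilinear)
qed

lemma bounded_bilinear_matrix_vector_mult:
  "bounded_bilinear ((*v) :: complex^'n^'m \<Rightarrow> complex^'n \<Rightarrow> complex^'m)"
proof -
  have "bilinear ((*v) :: complex^'n^'m \<Rightarrow> complex^'n \<Rightarrow> complex^'m)"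
    by (auto simp: bilinear_def linear_iff matrix_vector_mult_def vec_eq_iff algebra_simps
          sum.distrib scaleR_sum_right)
  then show ?thesis by (simp add: bilinear_conv_bounded_bilinear)
qed

lemma bounded_linear_Re_trace: "bounded_linear (\<lambda>A :: complex^'n^'n. Re (trace A))"
  unfolding linear_conv_bounded_linear[symmetric]
  by (simp add: linear_iff trace_def sum.distrib scaleR_sum_right sum_distrib_left)

lemma Re_trace_add: "Re (trace (A + B)) = Re (trace A) + Re (trace B)"
  and Re_trace_diff: "Re (trace (A - B)) = Re (trace A) - Re (trace B)"
  and Re_trace_minus: "Re (trace (- A)) = - Re (trace A)"
  and Re_trace_scaleR: "Re (trace (r *\<^sub>R A)) = r * Re (trace A)"
  by (simp_all add: trace_def sum.distrib sum_subtractf sum_negf sum_distrib_left)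

lemma ctranspose_add: "ctranspose (A + B) = ctranspose A + ctranspose B"
  and ctranspose_diff: "ctranspose (A - B) = ctranspose A - ctranspose B"
  and ctranspose_minus: "ctranspose (- A) = - ctranspose A"
  and ctranspose_scaleR: "ctranspose (r *\<^sub>R A) = r *\<^sub>R ctranspose A"
  and ctranspose_ctranspose: "ctranspose (ctranspose A) = A"
  and ctranspose_mat_1: "ctranspose (mat 1 :: complex^'n^'n) = mat 1"
  by (auto simp: ctranspose_def vec_eq_iff mat_def)

lemma ctranspose_mult: "ctranspose (A ** B) = ctranspose B ** ctranspose A"
  by (simp add: ctranspose_def vec_eq_iff matrix_matrix_mult_def mult.commute)

lemma linear_ctranspose: "linear ctranspose"
  by (simp add: linear_iff ctranspose_add ctranspose_scaleR)

lemma subspace_herm_matrices: "subspace (herm_matrices :: (complex^'n^'n) set)"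
  using linear_0[OF linear_ctranspose]
  by (auto simp: subspace_def herm_matrices_def ctranspose_add ctranspose_scaleR)

lemma Re_vec_inner: "Re (vec_inner x y) = x \<bullet> y"
  by (simp add: vec_inner_def inner_vec_def inner_complex_def)

lemma vec_inner_commute: "cnj (vec_inner x y) = vec_inner y x"
  by (simp add: vec_inner_def mult.commute)

lemma vec_inner_matrix_left: "vec_inner (A *v x) y = vec_inner x (ctranspose A *v y)"
  unfolding vec_inner_def matrix_vector_mult_def ctranspose_def
  by (simp add: sum_distrib_left sum_distrib_right)
     (subst sum.swap, simp add: mult_ac)

lemma inner_matrix_left: "(A *v x) \<bullet> y = x \<bullet> (ctranspose A *v y)"
  by (metis Re_vec_inner vec_inner_matrix_left)

text \<open>
  The trace of \<open>A\<^sup>H B\<close> is the Frobenius inner product, whose real part is the inner product on the type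
  of matrices.
\<close>

lemma Re_trace_ctranspose_mult: "Re (trace (ctranspose A ** B)) = A \<bullet> B"
proof -
  have "trace (ctranspose A ** B) = (\<Sum>j\<in>UNIV. \<Sum>i\<in>UNIV. cnj (A $ i $ j) * B $ i $ j)"
    by (simp add: trace_def ctranspose_def matrix_matrix_mult_def)
  also have "\<dots> = (\<Sum>i\<in>UNIV. \<Sum>j\<in>UNIV. cnj (A $ i $ j) * B $ i $ j)"
    by (rule sum.swap)
  finally show ?thesis by (simp add: inner_vec_def inner_complex_def)
qed

lemma matrix_vector_mult_axis: "(A *v axis l 1) $ k = A $ k $ l"
  for A :: "'a::semiring_1^'n^'m"
  by (simp add: matrix_vector_mult_def axis_def if_distrib[of "\<lambda>c. _ * c"] sum.delta cong: if_cong)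

section \<open>Inversion of matrices\<close>

lemma matrix_inv_eqI:
  fixes A B :: "'a::field^'n^'n"
  assumes "A ** B = mat 1"
  shows "matrix_inv A = B"
proof -
  have BA: "B ** A = mat 1" using assms matrix_left_right_inverse by blast
  have "A ** matrix_inv A = mat 1 \<and> matrix_inv A ** A = mat 1"
    unfolding matrix_inv_def by (rule someI[of _ B]) (use assms BA in simp)
  then have "matrix_inv A = (B ** A) ** matrix_inv A" using BA by simp
  also have "\<dots> = B" using \<open>_ \<and> _\<close> by (metis matrix_mul_assoc matrix_mul_rid)
  finally show ?thesis .
qed

lemma matrix_inv_right: "invertible A \<Longrightarrow> A ** matrix_inv A = mat 1"
  and matrix_inv_left: "invertible A \<Longrightarrow> matrix_inv A ** A = mat 1"
  for A :: "'a::field^'n^'n"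
  by (metis invertible_def matrix_inv_eqI)+

lemma continuous_on_det:
  fixes f :: "'a::topological_space \<Rightarrow> complex^'n^'n"
  assumes "\<And>i j. continuous_on S (\<lambda>x. f x $ i $ j)"
  shows "continuous_on S (\<lambda>x. det (f x))"
  unfolding det_def by (intro continuous_intros assms)

text \<open>
  The right-hand side is a quotient of polynomials in the entries of \<open>A\<close>, from which the continuity of
  the inversion can be read off.
\<close>

lemma matrix_inv_cramer:
  fixes A :: "'a::field^'n^'n"
  assumes "invertible A"
  shows "matrix_inv A $ k $ l =
    det (\<chi> i j. if j = k then axis l 1 $ i else A $ i $ j) / det A"
proof -
  have "A *v (matrix_inv A *v axis l 1) = axis l 1"
    by (simp add: matrix_vector_mul_assoc matrix_inv_right[OF assms])
  then have "matrix_inv A *v axis l 1 =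
      (\<chi> k. det (\<chi> i j. if j = k then axis l 1 $ i else A $ i $ j) / det A)"
    by (rule cramer[THEN iffD1, rotated]) (use assms invertible_det_nz in blast)
  then show ?thesis by (simp add: vec_eq_iff matrix_vector_mult_axis)
qed

lemma continuous_on_matrix_inv:
  assumes "\<And>A. A \<in> S \<Longrightarrow> invertible A"
  shows "continuous_on S (matrix_inv :: complex^'n^'n \<Rightarrow> complex^'n^'n)"
proof -
  have "continuous_on S (\<lambda>A. det (\<chi> i j. if j = k then axis l 1 $ i else A $ i $ j) / det A
      :: complex)" for k l :: 'n
  proof (intro continuous_on_divide continuous_on_det ballI)
    show "det A \<noteq> 0" if "A \<in> S" for A
      using assms[OF that] invertible_det_nz by blast
    show "continuous_on S (\<lambda>A. (\<chi> i j. if j = k then axis l 1 $ i else A $ i $ j) $ i $ j :: complex)"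
      for i j by (cases "j = k") (auto intro!: continuous_intros)
  qed (intro continuous_intros)
  then have "continuous_on S (\<lambda>A. \<chi> k l. det (\<chi> i j. if j = k then axis l 1 $ i else A $ i $ j) / det A
      :: complex^'n^'n)"
    by (intro continuous_on_vec_lambda)
  then show ?thesis
    by (rule continuous_on_eq) (simp add: vec_eq_iff matrix_inv_cramer[OF assms])
qed

lemma open_invertible: "open {A :: complex^'n^'n. invertible A}"
proof -
  have "continuous_on UNIV (\<lambda>A :: complex^'n^'n. det A)"
    by (intro continuous_on_det continuous_intros)
  then show ?thesis
    unfolding invertible_det_nz by (auto intro!: open_Collect_neq continuous_intros)
qed

lemma matrix_inv_diff:
  fixes A B :: "complex^'n^'n"
  assumes "invertible A" "invertible B"
  shows "matrix_inv B - matrix_inv A = - (matrix_inv A ** (B - A) ** matrix_inv B)"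
  by (simp add: matmul.diff_left matmul.diff_right matrix_inv_left[OF assms(1)]
        matrix_mul_assoc[symmetric] matrix_inv_right[OF assms(2)])

text \<open>
  The difference quotient equals \<open>- P\<^sup>-\<^sup>1 V (P + t V)\<^sup>-\<^sup>1\<close> exactly, so that differentiability follows
  from continuity.
\<close>

lemma matrix_inv_has_derivative_along:
  fixes P V :: "complex^'n^'n"
  assumes "invertible P"
  shows "((\<lambda>t. matrix_inv (P + t *\<^sub>R V)) has_vector_derivative
           - (matrix_inv P ** V ** matrix_inv P)) (at 0)"
  unfolding has_vector_derivative_iff_quotient
proof -
  let ?Q = "\<lambda>t. - (matrix_inv P ** V ** matrix_inv (P + t *\<^sub>R V))"
  have line: "((\<lambda>t. P + t *\<^sub>R V) \<longlongrightarrow> P) (at 0)"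
    by (rule tendsto_eq_intros | simp)+
  have "isCont matrix_inv P"
  proof -
    have "continuous_on {A. invertible A} (matrix_inv :: complex^'n^'n \<Rightarrow> _)"
      by (rule continuous_on_matrix_inv) simp
    then show ?thesis
      unfolding continuous_on_eq_continuous_at[OF open_invertible] using assms by blast
  qed
  then have "((\<lambda>t. matrix_inv (P + t *\<^sub>R V)) \<longlongrightarrow> matrix_inv P) (at 0)"
    by (rule isCont_tendsto_compose[OF _ line])
  then have "(?Q \<longlongrightarrow> - (matrix_inv P ** V ** matrix_inv P)) (at 0)"
    by (intro tendsto_minus matmul.tendsto tendsto_const)
  moreover have "\<forall>\<^sub>F t in at 0. ?Q t =
      (matrix_inv (P + t *\<^sub>R V) - matrix_inv (P + 0 *\<^sub>R V)) /\<^sub>R (t - 0)"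
  proof -
    have "\<forall>\<^sub>F t in at 0. P + t *\<^sub>R V \<in> {A. invertible A}"
      using line open_invertible assms by (auto simp: tendsto_def)
    then show ?thesis
      using eventually_neq_at_within[of 0]
    proof eventually_elim
      case (elim t)
      then show ?case
        by (simp add: matrix_inv_diff[OF assms] matmul.scaleR_left matmul.scaleR_right)
    qed
  qed
  ultimately show "((\<lambda>t. (matrix_inv (P + t *\<^sub>R V) - matrix_inv (P + 0 *\<^sub>R V)) /\<^sub>R (t - 0))
      \<longlongrightarrow> - (matrix_inv P ** V ** matrix_inv P)) (at 0)"
    by (rule Lim_transform_eventually)
qed

text \<open>
  The derivative \<open>- P\<^sup>-\<^sup>1 X P\<^sup>-\<^sup>1\<close> is a product of inversions and a constant, so that it has order
  \<open>k\<close> as soon as the inversion has.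
\<close>

lemma Ck_on_matrix_inv:
  fixes V U :: "(complex^'n^'n) set"
  assumes V: "subspace V" "openin (top_of_set V) U" and inv: "\<And>A. A \<in> U \<Longrightarrow> invertible A"
  shows "Ck_on k V U matrix_inv"
proof (induction k)
  case 0
  then show ?case by (simp add: continuous_on_matrix_inv inv)
next
  case (Suc k)
  note bil = Ck_on_bounded_bilinear[OF matmul.bounded_bilinear_axioms _ _ V]
  show ?case
  proof (rule Ck_on_SucI)
    show "continuous_on U matrix_inv" by (simp add: continuous_on_matrix_inv inv)
    fix X assume "X \<in> V"
    have "Ck_on k V U (\<lambda>P. - (matrix_inv P ** X ** matrix_inv P))"
      by (intro Ck_on_bounded_linear[OF bounded_linear_minus[OF bounded_linear_ident] _ V]
            bil Suc.IH Ck_on_const)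
    then show "Ck_on k V U (\<lambda>P. dirderiv matrix_inv P X)"
      by (rule Ck_on_cong[OF V, rotated])
         (rule sym, rule dirderivI, rule matrix_inv_has_derivative_along, rule inv)
  qed (use matrix_inv_has_derivative_along inv in blast)
qed

section \<open>Hermitian positive definite matrices\<close>

lemma herm_vec_inner_real: "A \<in> herm_matrices \<Longrightarrow> vec_inner x (A *v x) \<in> \<real>"
  by (metis (mono_tags) Reals_cnj_iff herm_matrices_def mem_Collect_eq vec_inner_commute
      vec_inner_matrix_left)

text \<open>
  The form of a Hermitian matrix is real, and \<open>\<bullet>\<close> is the real part of the complex inner product. In
  this form positivity can be treated with real scalars and the Cauchy-Schwarz inequality.
\<close>

lemma hpd_matrices_iff:
  "A \<in> hpd_matrices \<longleftrightarrow> A \<in> herm_matrices \<and> (\<forall>x. x \<noteq> 0 \<longrightarrow> 0 < x \<bullet> (A *v x))"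
  using herm_vec_inner_real by (auto simp: hpd_matrices_def Re_vec_inner)

lemma hpd_invertible:
  assumes "P \<in> hpd_matrices"
  shows "invertible P"
proof -
  have "x = 0" if "P *v x = 0" for x
    using assms that unfolding hpd_matrices_iff by (metis inner_zero_right less_irrefl)
  then show ?thesis
    unfolding invertible_left_inverse matrix_left_invertible_ker by blast
qed

lemma mat_1_hpd: "mat 1 \<in> hpd_matrices"
  by (simp add: hpd_matrices_iff herm_matrices_def ctranspose_mat_1)

lemma convex_hpd_matrices: "convex (hpd_matrices :: (complex^'n^'n) set)"
proof (rule convexI)
  fix A B :: "complex^'n^'n" and u v :: real
  assume *: "A \<in> hpd_matrices" "B \<in> hpd_matrices" "0 \<le> u" "0 \<le> v" "u + v = 1"
  have herm: "u *\<^sub>R A + v *\<^sub>R B \<in> herm_matrices"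
    using * by (intro subspace_add subspace_scale subspace_herm_matrices) (auto simp: hpd_matrices_iff)
  have "0 < x \<bullet> ((u *\<^sub>R A + v *\<^sub>R B) *v x)" if "x \<noteq> 0" for x
  proof -
    have "x \<bullet> ((u *\<^sub>R A + v *\<^sub>R B) *v x) = u * (x \<bullet> (A *v x)) + v * (x \<bullet> (B *v x))"
      by (simp add: bounded_bilinear.add_left[OF bounded_bilinear_matrix_vector_mult]
          bounded_bilinear.scaleR_left[OF bounded_bilinear_matrix_vector_mult] inner_add_right)
    moreover have "0 < x \<bullet> (A *v x)" "0 < x \<bullet> (B *v x)"
      using * that by (auto simp: hpd_matrices_iff)
    moreover have "u > 0 \<or> v > 0" using * by linarith
    ultimately show ?thesis
      using * by (auto intro: add_pos_nonneg add_nonneg_pos)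
  qed
  with herm show "u *\<^sub>R A + v *\<^sub>R B \<in> hpd_matrices" by (simp add: hpd_matrices_iff)
qed

text \<open>
  The form of \<open>P\<close> is bounded below by a positive constant \<open>m\<close> on the compact unit sphere, and a
  perturbation of norm less than \<open>m / (K + 1)\<close>, where \<open>K\<close> bounds the matrix-vector product, changes it
  there by less than \<open>m\<close>.
\<close>

lemma openin_hpd_matrices:
  "openin (top_of_set herm_matrices) (hpd_matrices :: (complex^'n^'n) set)"
  unfolding openin_euclidean_subtopology_iff
proof (intro conjI ballI)
  show "hpd_matrices \<subseteq> herm_matrices" by (auto simp: hpd_matrices_iff)
next
  note mv = bounded_bilinear_matrix_vector_mult[where 'n='n and 'm='n]
  fix P :: "complex^'n^'n" assume P: "P \<in> hpd_matrices"
  obtain K where K: "0 \<le> K" "\<And>(A :: complex^'n^'n) x. norm (A *v x) \<le> norm A * norm x * K"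
    using bounded_bilinear.nonneg_bounded[OF mv] by metis
  obtain w :: "complex^'n" where w: "w \<in> sphere 0 1"
    "\<And>y. y \<in> sphere 0 1 \<Longrightarrow> w \<bullet> (P *v w) \<le> y \<bullet> (P *v y)"
  proof -
    have "continuous_on (sphere 0 1) (\<lambda>y. y \<bullet> (P *v y))"
      by (intro continuous_on_inner continuous_on_id bounded_bilinear.continuous_on[OF mv]
          continuous_on_const)
    then show ?thesis
      using continuous_attains_inf[of "sphere 0 1 :: (complex^'n) set" "\<lambda>y. y \<bullet> (P *v y)"] that
      by auto
  qed
  define m where "m = w \<bullet> (P *v w)"
  have "w \<noteq> 0" using w(1) by auto
  then have m: "m > 0" using P by (simp add: hpd_matrices_iff m_def)
  have low: "x \<bullet> (P *v x) \<ge> m * (norm x)\<^sup>2" if "x \<noteq> 0" for x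
  proof -
    have "m \<le> (x /\<^sub>R norm x) \<bullet> (P *v (x /\<^sub>R norm x))"
      unfolding m_def by (rule w(2)) (use that in simp)
    also have "\<dots> = (x \<bullet> (P *v x)) / (norm x)\<^sup>2"
      by (simp add: bounded_bilinear.scaleR_right[OF mv] power2_eq_square divide_simps)
    finally show ?thesis using that by (simp add: field_simps)
  qed
  show "\<exists>e>0. \<forall>Q\<in>herm_matrices. dist Q P < e \<longrightarrow> Q \<in> hpd_matrices"
  proof (intro exI[of _ "m / (K + 1)"] conjI ballI impI)
    show "0 < m / (K + 1)" using m K by simp
    fix Q :: "complex^'n^'n" assume Q: "Q \<in> herm_matrices" "dist Q P < m / (K + 1)"
    have "0 < x \<bullet> (Q *v x)" if x: "x \<noteq> 0" for x
    proof -
      have "\<bar>x \<bullet> ((Q - P) *v x)\<bar> \<le> norm x * norm ((Q - P) *v x)"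
        by (rule Cauchy_Schwarz_ineq2)
      also have "\<dots> \<le> norm x * (norm (Q - P) * norm x * K)"
        by (intro mult_left_mono K) auto
      also have "\<dots> = (norm (Q - P) * K) * (norm x)\<^sup>2"
        by (simp add: power2_eq_square)
      also have "\<dots> < m * (norm x)\<^sup>2"
      proof (rule mult_strict_right_mono)
        have "norm (Q - P) * (K + 1) < m" using Q(2) K by (simp add: dist_norm field_simps)
        then show "norm (Q - P) * K < m"
          using norm_ge_zero[of "Q - P"] unfolding distrib_left by linarith
      qed (use x in simp)
      also have "\<dots> \<le> x \<bullet> (P *v x)" by (rule low[OF x])
      finally have "\<bar>x \<bullet> ((Q - P) *v x)\<bar> < x \<bullet> (P *v x)" .
      moreover have "x \<bullet> (Q *v x) = x \<bullet> (P *v x) + x \<bullet> ((Q - P) *v x)"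
        by (simp add: bounded_bilinear.diff_left[OF mv] inner_diff_right)
      ultimately show ?thesis by linarith
    qed
    with Q(1) show "Q \<in> hpd_matrices" by (simp add: hpd_matrices_iff)
  qed
qed

lemma matrix_inv_herm:
  assumes "P \<in> herm_matrices" "invertible P"
  shows "matrix_inv P \<in> herm_matrices"
proof -
  have "P ** ctranspose (matrix_inv P) = mat 1"
    using assms matrix_inv_left[OF assms(2)]
    by (metis (mono_tags) ctranspose_mat_1 ctranspose_mult herm_matrices_def mem_Collect_eq)
  from matrix_inv_eqI[OF this] show ?thesis by (simp add: herm_matrices_def)
qed

text \<open>
  With \<open>x = P y\<close> the form of \<open>P\<^sup>-\<^sup>1\<close> at \<open>x\<close> is the form of \<open>P\<close> at \<open>y\<close>.
\<close>

lemma matrix_inv_hpd: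
  assumes "P \<in> hpd_matrices"
  shows "matrix_inv P \<in> hpd_matrices"
proof -
  have inv: "invertible P" by (rule hpd_invertible[OF assms])
  have P: "ctranspose P = P" using assms by (simp add: hpd_matrices_def herm_matrices_def)
  have "0 < x \<bullet> (matrix_inv P *v x)" if "x \<noteq> 0" for x
  proof -
    define y where "y = matrix_inv P *v x"
    have x: "x = P *v y"
      by (simp add: y_def matrix_vector_mul_assoc matrix_inv_right[OF inv])
    then have "y \<noteq> 0" using that by auto
    then have "0 < y \<bullet> (P *v y)" using assms by (simp add: hpd_matrices_iff)
    also have "\<dots> = x \<bullet> (matrix_inv P *v x)"
      unfolding y_def[symmetric] by (simp add: x inner_commute)
    finally show ?thesis .
  qed
  then show ?thesis
    using matrix_inv_herm[OF _ inv] assms by (simp add: hpd_matrices_iff)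
qed

section \<open>Gram factorisation of positive semidefinite matrices\<close>

definition psd_matrices :: "(complex^'n^'n) set" where
  "psd_matrices = {A \<in> herm_matrices. \<forall>x. 0 \<le> x \<bullet> (A *v x)}"

lemma vec_inner_diff_left: "vec_inner (x - y) z = vec_inner x z - vec_inner y z"
  and vec_inner_diff_right: "vec_inner z (x - y) = vec_inner z x - vec_inner z y"
  and vec_inner_scale_left: "vec_inner (a *s x) z = cnj a * vec_inner x z"
  and vec_inner_scale_right: "vec_inner z (a *s x) = a * vec_inner z x"
  by (simp_all add: vec_inner_def algebra_simps sum_subtractf sum_distrib_left)

text \<open>
  With \<open>y = P e\<close>, the form at \<open>y + t e\<close> is the affine function \<open>y \<bullet> P y + 2 t (y \<bullet> y)\<close> of \<open>t\<close>. It is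
  nonnegative for all \<open>t\<close>, hence constant.
\<close>

lemma psd_null_vector:
  assumes P: "P \<in> psd_matrices" and e: "e \<bullet> (P *v e) = 0"
  shows "P *v e = 0"
proof -
  define y where "y = P *v e"
  have sym: "e \<bullet> (P *v y) = y \<bullet> y"
    using P inner_matrix_left[of P e y] by (simp add: psd_matrices_def herm_matrices_def y_def)
  define a where "a = y \<bullet> (P *v y)"
  have poly: "0 \<le> a + 2 * t * (y \<bullet> y)" for t :: real
  proof -
    have "(y + t *\<^sub>R e) \<bullet> (P *v (y + t *\<^sub>R e)) = a + 2 * t * (y \<bullet> y)"
      using e sym
      by (simp add: bounded_bilinear.add_right[OF bounded_bilinear_matrix_vector_mult]
          bounded_bilinear.scaleR_right[OF bounded_bilinear_matrix_vector_mult]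
          inner_add_left inner_add_right a_def y_def[symmetric])
    then show ?thesis using P unfolding psd_matrices_def by (metis (mono_tags, lifting) mem_Collect_eq)
  qed
  have "y \<bullet> y \<le> 0"
  proof (rule ccontr)
    assume "\<not> y \<bullet> y \<le> 0"
    then have "y \<bullet> y \<noteq> 0" by linarith
    \<comment> \<open>At this \<open>t\<close> the affine function has the value \<open>- 1\<close>.\<close>
    then have "2 * (- (a + 1) / (2 * (y \<bullet> y))) * (y \<bullet> y) = - (a + 1)"
      by (simp del: inner_eq_zero_iff)
    then show False using poly[of "- (a + 1) / (2 * (y \<bullet> y))"] by linarith
  qed
  then have "y \<bullet> y = 0" using inner_ge_zero[of y] by linarith
  then show ?thesis by (simp add: y_def)
qed

text \<open>
  Cholesky decomposition. If the column \<open>u = P e\<^sub>i\<close> does not vanish, then \<open>r = P\<^sub>i\<^sub>i > 0\<close> and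
  \<open>P - u u\<^sup>H / r\<close> is again positive semidefinite, annihilates \<open>e\<^sub>i\<close> and every standard basis vector that \<open>P\<close>
  annihilates. The index set \<open>I\<close> collects the basis vectors that are still to be treated.
\<close>

lemma psd_gram_sum:
  fixes P :: "complex^'n^'n"
  assumes "finite I" "P \<in> psd_matrices" "\<And>i. i \<notin> I \<Longrightarrow> P *v axis i 1 = 0"
  shows "\<exists>v :: 'n \<Rightarrow> complex^'n. \<forall>a b. P $ a $ b = (\<Sum>k\<in>I. v k $ a * cnj (v k $ b))"
  using assms
proof (induction I arbitrary: P rule: finite_induct)
  case empty
  have "P $ a $ b = 0" for a b
    using empty.prems(2)[of b] by (simp flip: matrix_vector_mult_axis)
  then show ?case by simp
next
  case (insert i I)
  define e :: "complex^'n" where "e = axis i 1"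
  define u where "u = P *v e"
  show ?case
  proof (cases "u = 0")
    case True
    then have "P *v axis j 1 = 0" if "j \<notin> I" for j
      using insert.prems(2)[of j] that by (cases "j = i") (auto simp: u_def e_def)
    from insert.IH[OF insert.prems(1) this] obtain v :: "'n \<Rightarrow> complex^'n"
      where v: "\<And>a b. P $ a $ b = (\<Sum>k\<in>I. v k $ a * cnj (v k $ b))" by blast
    have "P $ a $ b = (\<Sum>k\<in>insert i I. (v(i := 0)) k $ a * cnj ((v(i := 0)) k $ b))" for a b
      using insert.hyps by (simp add: v) (rule sum.cong, auto)
    then show ?thesis by blast
  next
    case False
    define r where "r = e \<bullet> (P *v e)"
    have herm: "ctranspose P = P" "P \<in> herm_matrices"
      using insert.prems(1) by (auto simp: psd_matrices_def herm_matrices_def)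
    have adj: "vec_inner (P *v x) y = vec_inner x (P *v y)" for x y
      by (simp add: vec_inner_matrix_left herm)
    have "r \<ge> 0" using insert.prems(1) by (simp add: psd_matrices_def r_def)
    moreover have "r \<noteq> 0"
      using psd_null_vector[OF insert.prems(1), of e] False by (auto simp: r_def u_def)
    ultimately have r: "r > 0" by simp
    have eu: "vec_inner e u = of_real r"
      using herm_vec_inner_real[OF herm(2), of e]
      by (simp add: r_def u_def Re_vec_inner[symmetric])
    define P' where "P' = P - (\<chi> a b. u $ a * cnj (u $ b) / of_real r)"
    have P'x: "P' *v x = P *v x - (vec_inner u x / of_real r) *s u" for x
      by (simp add: P'_def bounded_bilinear.diff_left[OF bounded_bilinear_matrix_vector_mult])
         (simp add: vec_eq_iff matrix_vector_mult_def vec_inner_def sum_distrib_left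
            sum_divide_distrib mult_ac)
    have "ctranspose P' = P'"
    proof -
      have "ctranspose (\<chi> a b. u $ a * cnj (u $ b) / of_real r) = (\<chi> a b. u $ a * cnj (u $ b) / of_real r)"
        by (simp add: ctranspose_def vec_eq_iff)
      then show ?thesis by (simp add: P'_def ctranspose_diff herm)
    qed
    moreover have "0 \<le> x \<bullet> (P' *v x)" for x
    proof -
      \<comment> \<open>The form of \<open>P'\<close> at \<open>x\<close> is the form of \<open>P\<close> at \<open>x - a e\<close>, the component of \<open>x\<close> that is
        orthogonal to \<open>e\<close> with respect to \<open>P\<close>.\<close>
      define a where "a = vec_inner u x / of_real r"
      have ux: "vec_inner u x = a * of_real r" using r by (simp add: a_def)
      have xu: "vec_inner x u = cnj a * of_real r"
        using vec_inner_commute[of u x] by (simp add: ux)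
      have ePx: "vec_inner e (P *v x) = a * of_real r"
        using adj[of e x] by (simp add: ux u_def[symmetric])
      have Pe: "P *v (a *s e) = a *s u"
        by (simp add: u_def vector_scalar_commute)
      have "vec_inner (x - a *s e) (P *v (x - a *s e)) = vec_inner x (P' *v x)"
        unfolding P'x a_def[symmetric]
        by (simp add: vec_inner_diff_left vec_inner_diff_right vec_inner_scale_left
            vec_inner_scale_right xu ePx eu Pe algebra_simps)
      then have "(x - a *s e) \<bullet> (P *v (x - a *s e)) = x \<bullet> (P' *v x)"
        by (metis Re_vec_inner)
      then show ?thesis
        using insert.prems(1) unfolding psd_matrices_def by (metis (mono_tags, lifting) mem_Collect_eq)
    qed
    ultimately have psd': "P' \<in> psd_matrices" by (simp add: psd_matrices_def herm_matrices_def)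
    have null: "P' *v axis j 1 = 0" if "j \<notin> I" for j
    proof (cases "j = i")
      case True
      have "vec_inner u e = of_real r" using vec_inner_commute[of e u] by (simp add: eu)
      then show ?thesis using True r by (simp add: P'x e_def[symmetric] u_def[symmetric])
    next
      case False
      then have "P *v axis j 1 = 0" using insert.prems(2) that by auto
      then show ?thesis using adj[of e "axis j 1"] by (simp add: P'x u_def[symmetric] vec_inner_def)
    qed
    obtain v :: "'n \<Rightarrow> complex^'n"
      where v: "\<And>a b. P' $ a $ b = (\<Sum>k\<in>I. v k $ a * cnj (v k $ b))"
      using insert.IH[OF psd' null] by blast
    define w where "w = v(i := complex_of_real (1 / sqrt r) *s u)"
    have "P $ a $ b = (\<Sum>k\<in>insert i I. w k $ a * cnj (w k $ b))" for a b
    proof -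
      have "(\<Sum>k\<in>insert i I. w k $ a * cnj (w k $ b)) =
          w i $ a * cnj (w i $ b) + (\<Sum>k\<in>I. w k $ a * cnj (w k $ b))"
        using insert.hyps by simp
      also have "(\<Sum>k\<in>I. w k $ a * cnj (w k $ b)) = P' $ a $ b"
        unfolding v using insert.hyps by (intro sum.cong) (auto simp: w_def)
      also have "w i $ a * cnj (w i $ b) = u $ a * cnj (u $ b) / of_real r"
      proof -
        have "complex_of_real (sqrt r) * complex_of_real (sqrt r) = of_real r"
          using r by (simp flip: of_real_mult)
        then show ?thesis using r by (simp add: w_def)
      qed
      finally show ?thesis by (simp add: P'_def)
    qed
    then show ?thesis by blast
  qed
qed

lemma psd_gram:
  fixes P :: "complex^'n^'n"
  assumes "P \<in> psd_matrices"
  obtains R :: "complex^'n^'n" where "P = R ** ctranspose R"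
proof -
  obtain v :: "'n \<Rightarrow> complex^'n" where v: "\<And>a b. P $ a $ b = (\<Sum>k\<in>UNIV. v k $ a * cnj (v k $ b))"
    using psd_gram_sum[of UNIV P] assms by auto
  have "P = (\<chi> a k. v k $ a) ** ctranspose (\<chi> a k. v k $ a)"
    by (simp add: vec_eq_iff matrix_matrix_mult_def ctranspose_def v)
  then show ?thesis by (rule that)
qed

section \<open>The trace metric on positive definite matrices\<close>

lemma hpd_manifold_simps:
  "tangent hpd_manifold = herm_matrices"
  "points hpd_manifold = hpd_matrices"
  "rmetric hpd_manifold P X Y = Re (trace (matrix_inv P ** X ** matrix_inv P ** Y))"
  by (simp_all add: hpd_manifold_def)

text \<open>
  With \<open>P\<^sup>-\<^sup>1 = R R\<^sup>H\<close> and the Hermitian matrix \<open>T = R\<^sup>H X R\<close>, cyclicity of the trace turns the value into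
  \<open>tr (T T) = \<parallel>T\<parallel>\<^sup>2\<close>. If \<open>T\<close> vanished, so would \<open>R T R\<^sup>H = P\<^sup>-\<^sup>1 X P\<^sup>-\<^sup>1\<close>, and with it \<open>X\<close>.
\<close>

lemma trace_metric_pos:
  fixes P X :: "complex^'n^'n"
  assumes P: "P \<in> hpd_matrices" and X: "X \<in> herm_matrices" "X \<noteq> 0"
  shows "0 < Re (trace (matrix_inv P ** X ** matrix_inv P ** X))"
proof -
  have inv: "invertible P" by (rule hpd_invertible[OF P])
  have "matrix_inv P \<in> psd_matrices"
  proof -
    have "0 \<le> x \<bullet> (matrix_inv P *v x)" for x
      using matrix_inv_hpd[OF P] by (cases "x = 0") (auto simp: hpd_matrices_iff less_imp_le)
    then show ?thesis
      using matrix_inv_hpd[OF P] by (simp add: psd_matrices_def hpd_matrices_iff)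
  qed
  then obtain R :: "complex^'n^'n" where R: "matrix_inv P = R ** ctranspose R" by (rule psd_gram)
  define T where "T = ctranspose R ** X ** R"
  have T: "ctranspose T = T"
    using X by (simp add: T_def herm_matrices_def ctranspose_mult ctranspose_ctranspose matrix_mul_assoc)
  have "trace (matrix_inv P ** X ** matrix_inv P ** X) =
      trace (R ** (ctranspose R ** X ** R ** ctranspose R ** X))"
    by (simp add: R matrix_mul_assoc)
  also have "\<dots> = trace (ctranspose R ** X ** R ** ctranspose R ** X ** R)"
    by (rule trace_mul_sym)
  also have "\<dots> = trace (ctranspose T ** T)"
    unfolding T by (simp add: T_def matrix_mul_assoc)
  finally have eq: "Re (trace (matrix_inv P ** X ** matrix_inv P ** X)) = T \<bullet> T"
    by (simp add: Re_trace_ctranspose_mult)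
  have "T \<noteq> 0"
  proof
    assume "T = 0"
    then have "R ** T ** ctranspose R = 0" by (simp add: matmul.zero_left matmul.zero_right)
    then have "matrix_inv P ** X ** matrix_inv P = 0"
      by (simp add: T_def R matrix_mul_assoc)
    then have "P ** (matrix_inv P ** X ** matrix_inv P) ** P = 0"
      by (simp add: matmul.zero_left matmul.zero_right)
    then have "(P ** matrix_inv P) ** X ** (matrix_inv P ** P) = 0"
      by (simp add: matrix_mul_assoc)
    then show False using X by (simp add: matrix_inv_left[OF inv] matrix_inv_right[OF inv])
  qed
  then show ?thesis by (simp add: eq)
qed

lemma riemannian_hpd: "riemannian_manifold (hpd_manifold :: (complex^'n^'n) open_mfd)"
  unfolding riemannian_manifold_def hpd_manifold_simps
proof (intro conjI ballI allI impI)
  show "subspace (herm_matrices :: (complex^'n^'n) set)" by (rule subspace_herm_matrices)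
  show "openin (top_of_set herm_matrices) (hpd_matrices :: (complex^'n^'n) set)"
    by (rule openin_hpd_matrices)
  show "hpd_matrices \<noteq> ({} :: (complex^'n^'n) set)" using mat_1_hpd by blast
next
  fix P X Y :: "complex^'n^'n"
  show "Re (trace (matrix_inv P ** X ** matrix_inv P ** Y)) =
      Re (trace (matrix_inv P ** Y ** matrix_inv P ** X))"
    using trace_mul_sym[of "matrix_inv P ** X" "matrix_inv P ** Y"] by (simp add: matrix_mul_assoc)
next
  fix P X Y Z :: "complex^'n^'n" and a b :: real
  show "Re (trace (matrix_inv P ** (a *\<^sub>R X + b *\<^sub>R Y) ** matrix_inv P ** Z)) =
      a * Re (trace (matrix_inv P ** X ** matrix_inv P ** Z)) +
      b * Re (trace (matrix_inv P ** Y ** matrix_inv P ** Z))"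
    by (simp add: matmul.add_left matmul.add_right matmul.scaleR_left matmul.scaleR_right
        Re_trace_add Re_trace_scaleR)
next
  fix P X :: "complex^'n^'n"
  assume "P \<in> hpd_matrices" "X \<in> herm_matrices" "X \<noteq> 0"
  then show "0 < Re (trace (matrix_inv P ** X ** matrix_inv P ** X))" by (rule trace_metric_pos)
next
  fix X Y :: "complex^'n^'n"
  note V = subspace_herm_matrices openin_hpd_matrices
  show "smooth_on herm_matrices hpd_matrices
      (\<lambda>P. Re (trace (matrix_inv P ** X ** matrix_inv P ** Y)))"
    unfolding smooth_on_def
    by (intro allI Ck_on_bounded_linear[OF bounded_linear_Re_trace _ V] Ck_on_const
        Ck_on_matrix_inv[OF V] Ck_on_bounded_bilinear[OF matmul.bounded_bilinear_axioms _ _ V])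
       (auto intro: hpd_invertible)
qed

text \<open>
  The first derivatives of the trace metric are, up to sign, sums of two such values. Cyclicity leaves just two different values
  for three given directions, and that is why the Koszul formula collapses.
\<close>

definition cubic_trace :: "complex^'n^'n \<Rightarrow> complex^'n^'n \<Rightarrow> complex^'n^'n \<Rightarrow> complex^'n^'n \<Rightarrow> real" where
  "cubic_trace P X Y Z =
     Re (trace (matrix_inv P ** X ** matrix_inv P ** Y ** matrix_inv P ** Z))"

lemma cubic_trace_rotate: "cubic_trace P X Y Z = cubic_trace P Y Z X"
  using trace_mul_sym[of "matrix_inv P ** X" "matrix_inv P ** Y ** matrix_inv P ** Z"]
  by (simp add: cubic_trace_def matrix_mul_assoc)

lemma dirderiv_trace_metric:
  assumes "invertible P"
  shows "dirderiv (\<lambda>Q. Re (trace (matrix_inv Q ** X ** matrix_inv Q ** Y))) P V =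
    - cubic_trace P V X Y - cubic_trace P X V Y"
proof (rule dirderivI)
  note bil = bounded_bilinear.has_vector_derivative[OF matmul.bounded_bilinear_axioms]
  note inv = matrix_inv_has_derivative_along[OF assms, of V]
  have "((\<lambda>t. matrix_inv (P + t *\<^sub>R V) ** X ** matrix_inv (P + t *\<^sub>R V) ** Y) has_vector_derivative
      - (matrix_inv P ** V ** matrix_inv P ** X ** matrix_inv P ** Y)
      - (matrix_inv P ** X ** matrix_inv P ** V ** matrix_inv P ** Y)) (at 0)"
    by (rule has_vector_derivative_eq_rhs,
        rule bil[OF bil[OF bil[OF inv has_vector_derivative_const] inv] has_vector_derivative_const])
       (simp add: matmul.add_left matmul.diff_left matmul.minus_left matmul.minus_right matmul.zero_left
         matmul.zero_right matrix_mul_assoc)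
  from bounded_linear.has_vector_derivative[OF bounded_linear_Re_trace this]
  show "((\<lambda>t. Re (trace (matrix_inv (P + t *\<^sub>R V) ** X ** matrix_inv (P + t *\<^sub>R V) ** Y)))
      has_vector_derivative - cubic_trace P V X Y - cubic_trace P X V Y) (at 0)"
    by (simp add: cubic_trace_def Re_trace_diff Re_trace_minus)
qed

text \<open>
  By cyclicity each of the three derivatives on the right-hand side of the Koszul formula is
  \<open>- (cubic_trace P X Y Z + cubic_trace P Y X Z)\<close>. Two of them enter with the sign \<open>+\<close> and one with \<open>-\<close>, so
  one copy remains, which the metric represents by the symmetrised product.
\<close>

lemma koszul_hpd:
  fixes P X Y :: "complex^'n^'n"
  assumes P: "P \<in> hpd_matrices" and X: "X \<in> herm_matrices" and Y: "Y \<in> herm_matrices"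
  shows "koszul hpd_manifold P X Y (- (1/2) *\<^sub>R (X ** matrix_inv P ** Y + Y ** matrix_inv P ** X))"
    (is "koszul _ _ _ _ ?W")
  unfolding koszul_def hpd_manifold_simps
proof (intro conjI ballI)
  have inv: "invertible P" by (rule hpd_invertible[OF P])
  have Q: "matrix_inv P \<in> herm_matrices" using matrix_inv_hpd[OF P] by (simp add: hpd_matrices_iff)
  show "?W \<in> herm_matrices"
    using Q X Y
    by (simp add: herm_matrices_def ctranspose_scaleR ctranspose_minus ctranspose_add ctranspose_mult
        matrix_mul_assoc add.commute)
  fix Z :: "complex^'n^'n"
  have "2 * Re (trace (matrix_inv P ** ?W ** matrix_inv P ** Z)) =
      - (cubic_trace P X Y Z + cubic_trace P Y X Z)"
    by (simp add: cubic_trace_def matmul.add_left matmul.add_right matmul.scaleR_left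
        matmul.scaleR_right matmul.minus_left matmul.minus_right matmul.diff_left matmul.diff_right
        Re_trace_add Re_trace_diff Re_trace_minus Re_trace_scaleR matrix_mul_assoc field_simps)
  then show "2 * Re (trace (matrix_inv P ** ?W ** matrix_inv P ** Z)) =
      dirderiv (\<lambda>Q. Re (trace (matrix_inv Q ** Y ** matrix_inv Q ** Z))) P X
      + dirderiv (\<lambda>Q. Re (trace (matrix_inv Q ** X ** matrix_inv Q ** Z))) P Y
      - dirderiv (\<lambda>Q. Re (trace (matrix_inv Q ** X ** matrix_inv Q ** Y))) P Z"
    unfolding dirderiv_trace_metric[OF inv]
    using cubic_trace_rotate[of P Z X Y] cubic_trace_rotate[of P X Z Y]
      cubic_trace_rotate[of P Z Y X] cubic_trace_rotate[of P Y X Z]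
    by linarith
qed

section \<open>Block circulant matrices and the T-product\<close>

text \<open>
  Inverse of \<open>pos\<close>, extended periodically to all integers.
\<close>

definition idx :: "int \<Rightarrow> 'p::{finite,linorder}" where
  "idx i = (THE k. pos k = i mod int CARD('p))"

lemma pos_inject: "pos k = pos l \<longleftrightarrow> k = l"
  using pos_bij by (metis UNIV_I bij_betw_imp_inj_on injD)

lemma pos_range: "0 \<le> pos (k :: 'p::{finite,linorder})" "pos k < int CARD('p)"
proof -
  have "pos k \<in> {0..<int CARD('p)}" using bij_betwE[OF pos_bij] by blast
  then show "0 \<le> pos k" "pos k < int CARD('p)" by auto
qed

lemma pos_idx: "pos (idx i :: 'p::{finite,linorder}) = i mod int CARD('p)"
proof -
  have "i mod int CARD('p) \<in> {0..<int CARD('p)}" by simp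
  then obtain k :: 'p where "pos k = i mod int CARD('p)"
    using bij_betw_imp_surj_on[OF pos_bij] by (metis imageE)
  then show ?thesis
    unfolding idx_def by (rule theI) (metis \<open>pos k = _\<close> pos_inject)
qed

lemma idx_eqI: "i mod int CARD('p) = pos k \<Longrightarrow> idx i = (k :: 'p::{finite,linorder})"
  by (metis pos_idx pos_inject)

lemma slice_idx: "slice A i = A $ idx i"
  by (simp add: slice_def idx_def)

lemma bcirc_nth: "bcirc A $ (k, i) $ (l, j) = A $ idx (pos k - pos l) $ i $ j"
  by (simp add: bcirc_def slice_idx)

lemma linear_bcirc: "linear bcirc"
  by (simp add: linear_iff vec_eq_iff bcirc_nth split_paired_All)

text \<open>
  The first block column of \<open>bcirc A\<close> lists the slices of \<open>A\<close>; its index is \<open>idx 0\<close>, the least element.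
\<close>

lemma inj_bcirc: "inj (bcirc :: complex^'n^'m^'p::{finite,linorder} \<Rightarrow> _)"
proof (rule injI)
  fix A B :: "complex^'n^'m^'p::{finite,linorder}"
  assume eq: "bcirc A = bcirc B"
  have "idx (pos k - pos (idx 0 :: 'p)) = k" for k :: 'p
    by (rule idx_eqI) (simp add: pos_idx pos_range)
  then have "A $ k $ i $ j = B $ k $ i $ j" for k i j
    using arg_cong[OF eq, of "\<lambda>M. M $ (k, i) $ (idx 0, j)"] by (simp add: bcirc_nth)
  then show "A = B" by (simp add: vec_eq_iff)
qed

text \<open>
  Both sides are cyclic convolutions of the slices, and summation over one period is invariant under
  a shift. The left-hand side is summed over the positions of the slices of \<open>B\<close>, the right-hand side over
  the block columns of \<open>bcirc A\<close>; the two differ by the block column index \<open>c\<close> of the entry.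
\<close>

lemma bcirc_tprod: "bcirc (A \<star> B) = bcirc A ** bcirc B"
  for A :: "complex^'n^'m^'p::{finite,linorder}" and B :: "complex^'l^'n^'p::{finite,linorder}"
proof -
  have "bcirc (A \<star> B) $ (r, i) $ (c, j) = (bcirc A ** bcirc B) $ (r, i) $ (c, j)" for r i c j
  proof -
    have "bcirc (A \<star> B) $ (r, i) $ (c, j) =
        (\<Sum>(l, m)\<in>UNIV. A $ idx (pos (idx (pos r - pos c) :: 'p) - pos l) $ i $ m * B $ l $ m $ j)"
      by (simp add: bcirc_nth tprod_def fold_def unfold_def matrix_matrix_mult_def
          case_prod_unfold bcirc_def slice_idx)
    also have "\<dots> = (\<Sum>(l :: 'p, m)\<in>UNIV. A $ idx (pos r - pos l) $ i $ m * B $ idx (pos l - pos c) $ m $ j)"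
    proof -
      have fwd: "idx (pos (idx (pos l + pos c) :: 'p) - pos c) = l" for l :: 'p
        by (rule idx_eqI) (simp add: pos_idx mod_simps pos_range)
      have bwd: "idx (pos (idx (pos l - pos c) :: 'p) + pos c) = l" for l :: 'p
        by (rule idx_eqI) (simp add: pos_idx mod_simps pos_range)
      have first: "idx (pos r - pos (idx (pos l + pos c) :: 'p)) =
          (idx (pos (idx (pos r - pos c) :: 'p) - pos l) :: 'p)" for l :: 'p
        by (rule idx_eqI) (simp add: pos_idx mod_simps algebra_simps)
      show ?thesis
        by (rule sum.reindex_bij_witness[where
              i = "\<lambda>(l, m). (idx (pos l - pos c), m)" and j = "\<lambda>(l, m). (idx (pos l + pos c), m)"])
           (auto simp: fwd bwd first)
    qed
    also have "\<dots> = (bcirc A ** bcirc B) $ (r, i) $ (c, j)"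
      by (simp add: matrix_matrix_mult_def case_prod_unfold bcirc_def slice_idx)
    finally show ?thesis .
  qed
  then show ?thesis by (simp add: vec_eq_iff split_paired_All)
qed

lemma bcirc_tident: "bcirc (tident :: complex^'n^'n^'p::{finite,linorder}) = mat 1"
proof -
  have "(pos k - pos l) mod int CARD('p) = 0 \<longleftrightarrow> k = l" for k l :: 'p
  proof
    assume "(pos k - pos l) mod int CARD('p) = 0"
    then have "pos k mod int CARD('p) = pos l mod int CARD('p)" by (metis mod_eq_dvd_iff dvd_eq_mod_eq_0)
    then show "k = l" by (simp add: pos_range pos_inject)
  qed simp
  then show ?thesis
    by (simp add: vec_eq_iff split_paired_All bcirc_nth tident_def pos_idx mat_def)
qed

lemma bcirc_tctranspose: "bcirc (tctranspose A) = ctranspose (bcirc A)"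
  for A :: "complex^'n^'m^'p::{finite,linorder}"
proof -
  have "idx (- pos (idx (pos k - pos l) :: 'p)) = (idx (pos l - pos k) :: 'p)" for k l :: 'p
    by (rule idx_eqI) (simp add: pos_idx mod_simps)
  then show ?thesis
    by (simp add: vec_eq_iff split_paired_All bcirc_nth tctranspose_def ctranspose_def slice_idx)
qed

lemma therm_iff: "A \<in> therm_tensors \<longleftrightarrow> bcirc A \<in> herm_matrices"
  by (simp add: therm_tensors_def herm_matrices_def flip: bcirc_tctranspose)
     (metis injD inj_bcirc)

text \<open>
  A tensor with one lateral slice is the same as a vector of length \<open>np\<close>, and under this identification
  the T-product with \<open>A\<close> is multiplication by \<open>bcirc A\<close>.
\<close>

lemma tensor_inner_tprod:
  fixes A :: "complex^'n^'n^'p::{finite,linorder}" and x :: "complex^('p \<times> 'n)"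
  defines "X \<equiv> (\<chi> k i j. x $ (k, i)) :: complex^1^'n^'p::{finite,linorder}"
  shows "tensor_inner X (A \<star> X) = vec_inner x (bcirc A *v x)"
proof -
  have AX: "(A \<star> X) $ k $ i $ j = (bcirc A *v x) $ (k, i)" for k i j
    by (simp add: tprod_def fold_def unfold_def X_def matrix_matrix_mult_def matrix_vector_mult_def)
  have "tensor_inner X (A \<star> X) =
      (\<Sum>i\<in>UNIV. \<Sum>k\<in>UNIV. cnj (x $ (k, i)) * (bcirc A *v x) $ (k, i))"
    by (simp add: tensor_inner_def AX) (simp add: X_def)
  also have "\<dots> = (\<Sum>k\<in>UNIV. \<Sum>i\<in>UNIV. cnj (x $ (k, i)) * (bcirc A *v x) $ (k, i))"
    by (rule sum.swap)
  also have "\<dots> = vec_inner x (bcirc A *v x)"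
    by (simp add: vec_inner_def sum.cartesian_product case_prod_unfold)
  finally show ?thesis .
qed

lemma tpd_iff: "A \<in> tpd_tensors \<longleftrightarrow> bcirc A \<in> hpd_matrices"
  for A :: "complex^'n^'n^'p::{finite,linorder}"
proof -
  let ?X = "\<lambda>x :: complex^('p \<times> 'n). (\<chi> k i j. x $ (k, i)) :: complex^1^'n^'p::{finite,linorder}"
  have surj: "\<exists>x. X = ?X x" for X
    by (rule exI[of _ "\<chi> r. X $ fst r $ snd r $ 1"]) (simp add: vec_eq_iff)
  have zero: "?X x = 0 \<longleftrightarrow> x = 0" for x
    by (simp add: vec_eq_iff split_paired_All)
  have "(\<forall>X :: complex^1^'n^'p::{finite,linorder}. X \<noteq> 0 \<longrightarrow> Q (tensor_inner X (A \<star> X))) \<longleftrightarrow>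
      (\<forall>x. x \<noteq> 0 \<longrightarrow> Q (vec_inner x (bcirc A *v x)))" for Q
    using surj zero tensor_inner_tprod[where A = A] by metis
  from this[of "\<lambda>z. z \<in> \<real> \<and> Re z > 0"] show ?thesis
    by (simp add: tpd_tensors_def hpd_matrices_def therm_iff)
qed

text \<open>
  The inverse of a block circulant matrix is block circulant. Folding the first block column of the matrix
  inverse yields a right T-inverse \<open>B\<close> without knowing this; multiplicativity then shows that \<open>bcirc B\<close>
  is the matrix inverse, and injectivity that \<open>B\<close> is also a left T-inverse.
\<close>

lemma bcirc_tinv:
  fixes P :: "complex^'n^'n^'p::{finite,linorder}"
  assumes "invertible (bcirc P)"
  shows "bcirc (tinv P) = matrix_inv (bcirc P)"
proof -
  define B where "B = fold (matrix_inv (bcirc P) ** unfold (tident :: complex^'n^'n^'p::{finite,linorder}))"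
  have right: "P \<star> B = tident"
    by (simp add: tprod_def B_def unfold_fold fold_unfold matrix_mul_assoc matrix_inv_right[OF assms])
  then have "bcirc P ** bcirc B = mat 1" by (metis bcirc_tprod bcirc_tident)
  then have "bcirc B ** bcirc P = mat 1" using matrix_left_right_inverse by blast
  then have left: "B \<star> P = tident" by (metis bcirc_tprod bcirc_tident injD inj_bcirc)
  have "P \<star> tinv P = tident \<and> tinv P \<star> P = tident"
    unfolding tinv_def by (rule someI[of _ B]) (use left right in simp)
  then have "bcirc P ** bcirc (tinv P) = mat 1" by (metis bcirc_tprod bcirc_tident)
  from matrix_inv_eqI[OF this] show ?thesis by simp
qed

section \<open>The positive definite tensors inside the positive definite matrices\<close>

lemma tpd_manifold_simps:
  "tangent tpd_manifold = therm_tensors"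
  "points tpd_manifold = tpd_tensors"
  "rmetric tpd_manifold P X Y = Re (ttrace (tinv P \<star> X \<star> tinv P \<star> Y))"
  by (simp_all add: tpd_manifold_def)

lemma convex_tpd_tensors: "convex (tpd_tensors :: (complex^'n^'n^'p::{finite,linorder}) set)"
proof -
  have "tpd_tensors = (bcirc :: complex^'n^'n^'p::{finite,linorder} \<Rightarrow> _) -` hpd_matrices" using tpd_iff by auto
  then show ?thesis using convex_linear_vimage[OF linear_bcirc convex_hpd_matrices] by metis
qed

lemma tident_tpd: "tident \<in> tpd_tensors"
  by (simp add: tpd_iff bcirc_tident mat_1_hpd)

lemma bcirc_pullback:
  "linear_pullback bcirc (tpd_manifold :: (complex^'n^'n^'p::{finite,linorder}) open_mfd) hpd_manifold"
proof (rule linear_pullback.intro)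
  show "linear (bcirc :: complex^'n^'n^'p::{finite,linorder} \<Rightarrow> _)" by (rule linear_bcirc)
  show "inj (bcirc :: complex^'n^'n^'p::{finite,linorder} \<Rightarrow> _)" by (rule inj_bcirc)
  show "X \<in> tangent tpd_manifold \<longleftrightarrow> bcirc X \<in> tangent hpd_manifold" for X :: "complex^'n^'n^'p::{finite,linorder}"
    by (simp add: tpd_manifold_simps hpd_manifold_simps therm_iff)
  show "P \<in> points tpd_manifold \<longleftrightarrow> bcirc P \<in> points hpd_manifold" for P :: "complex^'n^'n^'p::{finite,linorder}"
    by (simp add: tpd_manifold_simps hpd_manifold_simps tpd_iff)
  show "rmetric tpd_manifold P X Y = rmetric hpd_manifold (bcirc P) (bcirc X) (bcirc Y)"
    if "P \<in> points tpd_manifold" for P X Y :: "complex^'n^'n^'p::{finite,linorder}"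
    using that
    by (simp add: tpd_manifold_simps hpd_manifold_simps tpd_iff ttrace_def bcirc_tprod
        bcirc_tinv hpd_invertible)
  show "riemannian_manifold (hpd_manifold :: (complex^('p \<times> 'n)^('p \<times> 'n)) open_mfd)"
    by (rule riemannian_hpd)
  show "points (tpd_manifold :: (complex^'n^'n^'p::{finite,linorder}) open_mfd) \<noteq> {}"
    using tident_tpd by (auto simp: tpd_manifold_simps)
qed

text \<open>
  The solution \<open>- 1/2 (X P\<^sup>-\<^sup>1 Y + Y P\<^sup>-\<^sup>1 X)\<close> is built from products, inverses and linear combinations,
  all of which have counterparts for tensors.
\<close>

lemma koszul_bcirc_range:
  fixes P X Y :: "complex^'n^'n^'p::{finite,linorder}"
  assumes "P \<in> points tpd_manifold" "X \<in> tangent tpd_manifold" "Y \<in> tangent tpd_manifold"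
  shows "\<exists>W. koszul hpd_manifold (bcirc P) (bcirc X) (bcirc Y) (bcirc W)"
proof -
  have P: "bcirc P \<in> hpd_matrices" and XY: "bcirc X \<in> herm_matrices" "bcirc Y \<in> herm_matrices"
    using assms by (simp_all add: tpd_manifold_simps tpd_iff therm_iff)
  have "bcirc (- (1/2) *\<^sub>R (X \<star> tinv P \<star> Y + Y \<star> tinv P \<star> X)) =
      - (1/2) *\<^sub>R (bcirc X ** matrix_inv (bcirc P) ** bcirc Y + bcirc Y ** matrix_inv (bcirc P) ** bcirc X)"
    by (simp only: linear_scale[OF linear_bcirc] linear_add[OF linear_bcirc] bcirc_tprod
        bcirc_tinv[OF hpd_invertible[OF P]])
  then show ?thesis
    using koszul_hpd[OF P XY] by metis
qed

theorem theorem4p1: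
  shows "riemannian_manifold (tpd_manifold :: (complex^'n^'n^'p::{finite,linorder}) open_mfd) \<and>
         riemannian_manifold (hpd_manifold :: (complex^('p \<times> 'n)^('p \<times> 'n)) open_mfd) \<and>
         isometric_embedding bcirc
           (tpd_manifold :: (complex^'n^'n^'p::{finite,linorder}) open_mfd) hpd_manifold \<and>
         path_connected (points (tpd_manifold :: (complex^'n^'n^'p::{finite,linorder}) open_mfd)) \<and>
         simply_connected (points (tpd_manifold :: (complex^'n^'n^'p::{finite,linorder}) open_mfd)) \<and>
         totally_geodesic bcirc
           (tpd_manifold :: (complex^'n^'n^'p::{finite,linorder}) open_mfd) hpd_manifold"
proof -
  interpret linear_pullback bcirc
      "tpd_manifold :: (complex^'n^'n^'p::{finite,linorder}) open_mfd" hpd_manifold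
    by (rule bcirc_pullback)
  have "convex (points (tpd_manifold :: (complex^'n^'n^'p::{finite,linorder}) open_mfd))"
    unfolding tpd_manifold_simps by (rule convex_tpd_tensors)
  then show ?thesis
    using riemannian riemannian_hpd isometric convex_imp_path_connected convex_imp_simply_connected
      totally_geodesicI koszul_bcirc_range by metis
qed

end
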